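(* Let $n\ge2$ and let $A:\mathbb S_n(\mathbb R)\to\mathbb S_n(\mathbb R)$ be a linear map on the space of real symmetric $n\times n$ matrices. The following are equivalent: (i) $A$ extends to some completely cross-positive map $\widetilde A:M_n(\mathbb R)\to M_n(\mathbb R)$; (ii) $p_A$ is a sum of squares modulo $I$; (iii) $q_A$ is a sum of squares.
   Context: A linear map $B:M_n(\mathbb R)\to M_n(\mathbb R)$ is $*$-linear if $B(U^T)=B(U)^T$ for all $U$. A $*$-linear map $B$ is completely cross-positive if for every $k\in\mathbb N$ and all positive semidefinite (symmetric) $U,V\in M_{nk}(\mathbb R)\cong M_k(\mathbb R)\otimes M_n(\mathbb R)$ with $\langle U,V\rangle=0$ one has $\langle (I_k\otimes B)(U),V\rangle\ge0$, where $\langle C,D\rangle=\operatorname{tr}(D^TC)$ and $(I_k\otimes B)(U\otimes V)=U\otimes B(V)$. With $x=(x_1,\dots,x_n)$, $y=(y_1,\dots,y_n)$ (column) tuples of commuting variables, $p_A(x,y)=y^TA(xx^T)y\in\mathbb R[x,y]$, and $I\subseteq\mathbb R[x,y]$ is the ideal generated by $\sum_{i=1}^nx_iy_i$. A polynomial $p$ is a sum of squares modulo $I$ if $p-\sum_{i=1}^k p_i^2\in I$ for some $k$ and $p_i\in\mathbb R[x,y]$. With $\alpha=(\alpha_1,\dots,\alpha_{n-1})$ further variables, let $\Psi(x,\alpha)=(x,y)$, where $y_1=\alpha_1x_2$, $y_i=\alpha_ix_{i+1}-\alpha_{i-1}x_{i-1}$ for $i=2,\dots,n-1$, and $y_n=-\alpha_{n-1}x_{n-1}$.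 Then $q_A(x,\alpha)=p_A(\Psi(x,\alpha))\in\mathbb R[x,\alpha]$; in (iii), a sum of squares means a sum of squares of polynomials in $\mathbb R[x,\alpha]$. *)

theory Defs
  imports
    "HOL-Algebra.Ideal"
    "HOL-Library.Poly_Mapping"
    "Jordan_Normal_Form.Matrix"
begin

section \<open>Linear maps on matrix spaces\<close>

definition sym_mats :: "nat \<Rightarrow> real mat set" where
  "sym_mats n = {U \<in> carrier_mat n n. transpose_mat U = U}"

text \<open>Linear maps are total HOL functions; only their values on \<open>S\<close> are meaningful.\<close>

definition linear_between :: "real mat set \<Rightarrow> real mat set \<Rightarrow> (real mat \<Rightarrow> real mat) \<Rightarrow> bool" where
  "linear_between S T f \<longleftrightarrow>
     (\<forall>U\<in>S. f U \<in> T) \<and>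
     (\<forall>U\<in>S. \<forall>V\<in>S. f (U + V) = f U + f V) \<and>
     (\<forall>c. \<forall>U\<in>S. f (c \<cdot>\<^sub>m U) = c \<cdot>\<^sub>m f U)"

definition star_linear :: "nat \<Rightarrow> (real mat \<Rightarrow> real mat) \<Rightarrow> bool" where
  "star_linear n B \<longleftrightarrow>
     linear_between (carrier_mat n n) (carrier_mat n n) B \<and>
     (\<forall>U\<in>carrier_mat n n. B (transpose_mat U) = transpose_mat (B U))"


section \<open>Complete cross-positivity\<close>

definition psd_mats :: "nat \<Rightarrow> real mat set" where
  "psd_mats m = {U \<in> sym_mats m. \<forall>v\<in>carrier_vec m. v \<bullet> (U *\<^sub>v v) \<ge> 0}"

definition mat_trace :: "real mat \<Rightarrow> real" where
  "mat_trace U = (\<Sum>i<dim_row U. U $$ (i, i))"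

definition mat_inner :: "real mat \<Rightarrow> real mat \<Rightarrow> real" where
  "mat_inner C D = mat_trace (transpose_mat D * C)"

text \<open>
  An element of \<open>M\<^bsub>nk\<^esub> \<cong> M\<^sub>k \<otimes> M\<^sub>n\<close> is a \<open>k \<times> k\<close> array of \<open>n \<times> n\<close> blocks; index \<open>a * n + i\<close>
  of the large matrix is index \<open>i\<close> inside block \<open>a\<close>.
\<close>

definition kron :: "nat \<Rightarrow> nat \<Rightarrow> real mat \<Rightarrow> real mat \<Rightarrow> real mat" where
  "kron k n U V =
     mat (k * n) (k * n) (\<lambda>(r, c). U $$ (r div n, c div n) * V $$ (r mod n, c mod n))"

definition mat_block :: "nat \<Rightarrow> real mat \<Rightarrow> nat \<Rightarrow> nat \<Rightarrow> real mat" where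
  "mat_block n U a b = mat n n (\<lambda>(i, j). U $$ (a * n + i, b * n + j))"

text \<open>The map \<open>I\<^sub>k \<otimes> B\<close>: apply \<open>B\<close> to every block. By the lemma
  below it is the linear extension of \<open>U \<otimes> V \<mapsto> U \<otimes> B(V)\<close>.\<close>

definition ampliation :: "nat \<Rightarrow> nat \<Rightarrow> (real mat \<Rightarrow> real mat) \<Rightarrow> real mat \<Rightarrow> real mat" where
  "ampliation k n B U =
     mat (k * n) (k * n) (\<lambda>(r, c). B (mat_block n U (r div n) (c div n)) $$ (r mod n, c mod n))"

lemma ampliation_kron:
  assumes B: "linear_between (carrier_mat n n) (carrier_mat n n) B"
    and U: "U \<in> carrier_mat k k" and V: "V \<in> carrier_mat n n"
  shows "ampliation k n B (kron k n U V) = kron k n U (B V)"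
proof (rule eq_matI)
  fix r c
  assume "r < dim_row (kron k n U (B V))" "c < dim_col (kron k n U (B V))"
  then have rc: "r < k * n" "c < k * n" by (simp_all add: kron_def)
  then have n: "n > 0" by (cases n) auto
  have bound: "r div n < k" "c div n < k" "r mod n < n" "c mod n < n"
    using rc n by (auto simp: less_mult_imp_div_less)
  have ix: "a * n + i < k * n" if "a < k" "i < n" for a i
  proof -
    have "a * n + i < Suc a * n" using that by simp
    also have "\<dots> \<le> k * n" using that by (intro mult_right_mono) auto
    finally show ?thesis .
  qed
  have "mat_block n (kron k n U V) (r div n) (c div n) = U $$ (r div n, c div n) \<cdot>\<^sub>m V"
    using V bound n by (intro eq_matI) (auto simp: mat_block_def kron_def ix)
  moreover have "B (U $$ (r div n, c div n) \<cdot>\<^sub>m V) = U $$ (r div n, c div n) \<cdot>\<^sub>m B V"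
    and "B V \<in> carrier_mat n n"
    using B V by (auto simp: linear_between_def)
  ultimately show "ampliation k n B (kron k n U V) $$ (r, c) = kron k n U (B V) $$ (r, c)"
    using rc bound by (simp add: ampliation_def kron_def)
qed (simp_all add: ampliation_def kron_def)

definition completely_cross_positive :: "nat \<Rightarrow> (real mat \<Rightarrow> real mat) \<Rightarrow> bool" where
  "completely_cross_positive n B \<longleftrightarrow>
     star_linear n B \<and>
     (\<forall>k. \<forall>U\<in>psd_mats (k * n). \<forall>V\<in>psd_mats (k * n).
        mat_inner U V = 0 \<longrightarrow> mat_inner (ampliation k n B U) V \<ge> 0)"


section \<open>Polynomials\<close>

text \<open>
  All polynomials live in one ring with countably many variables; \<open>polys V\<close> is the subring
  of those in the variables \<open>V\<close>. Variables are indexed from \<open>1\<close>, as opposed to the entries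
  of matrices and vectors, which are indexed from \<open>0\<close>.
\<close>

datatype var = X nat | Y nat | Alpha nat

type_synonym rpoly = "(var \<Rightarrow>\<^sub>0 nat) \<Rightarrow>\<^sub>0 real"

definition Var :: "var \<Rightarrow> rpoly" where
  "Var v = Poly_Mapping.single (Poly_Mapping.single v 1) 1"

definition Const :: "real \<Rightarrow> rpoly" where
  "Const c = Poly_Mapping.single 0 c"

definition polys :: "var set \<Rightarrow> rpoly set" where
  "polys V = {p. \<forall>m\<in>Poly_Mapping.keys p. Poly_Mapping.keys m \<subseteq> V}"

definition poly_ring :: "var set \<Rightarrow> rpoly ring" where
  "poly_ring V = \<lparr>carrier = polys V, monoid.mult = (*), one = 1, zero = 0, add = (+)\<rparr>"

definition vars_xy :: "nat \<Rightarrow> var set" where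
  "vars_xy n = X ` {1..n} \<union> Y ` {1..n}"

definition vars_xa :: "nat \<Rightarrow> var set" where
  "vars_xa n = X ` {1..n} \<union> Alpha ` {1..n - 1}"

definition subst :: "(var \<Rightarrow> rpoly) \<Rightarrow> rpoly \<Rightarrow> rpoly" where
  "subst f p = (\<Sum>m\<in>Poly_Mapping.keys p.
     Const (Poly_Mapping.lookup p m) *
       (\<Prod>v\<in>Poly_Mapping.keys m. f v ^ Poly_Mapping.lookup m v))"


section \<open>The polynomials \<open>p\<^sub>A\<close> and \<open>q\<^sub>A\<close>\<close>

text \<open>
  The extension of a linear map \<open>A\<close> to matrices of polynomials. Writing \<open>P = \<Sum>\<^sub>m m P\<^sub>m\<close> with
  monomials \<open>m\<close> and real matrices \<open>P\<^sub>m\<close>, it is \<open>A(P) = \<Sum>\<^sub>m m A(P\<^sub>m)\<close>. If \<open>P\<close> is symmetric,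
  so is every \<open>P\<^sub>m\<close>, hence \<open>A\<close> need only be defined on symmetric matrices.
\<close>

definition coeff_mat :: "nat \<Rightarrow> rpoly mat \<Rightarrow> (var \<Rightarrow>\<^sub>0 nat) \<Rightarrow> real mat" where
  "coeff_mat n P m = mat n n (\<lambda>(r, c). Poly_Mapping.lookup (P $$ (r, c)) m)"

definition poly_ext :: "nat \<Rightarrow> (real mat \<Rightarrow> real mat) \<Rightarrow> rpoly mat \<Rightarrow> rpoly mat" where
  "poly_ext n A P = mat n n (\<lambda>(i, j).
     \<Sum>m\<in>(\<Union>r<n. \<Union>c<n. Poly_Mapping.keys (P $$ (r, c))).
       Poly_Mapping.single m (A (coeff_mat n P m) $$ (i, j)))"

definition x_vec :: "nat \<Rightarrow> rpoly vec" where
  "x_vec n = vec n (\<lambda>i. Var (X (i + 1)))"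

definition y_vec :: "nat \<Rightarrow> rpoly vec" where
  "y_vec n = vec n (\<lambda>i. Var (Y (i + 1)))"

definition xxT :: "nat \<Rightarrow> rpoly mat" where
  "xxT n = mat n n (\<lambda>(i, j). x_vec n $ i * x_vec n $ j)"

definition p_poly :: "nat \<Rightarrow> (real mat \<Rightarrow> real mat) \<Rightarrow> rpoly" where
  "p_poly n A = y_vec n \<bullet> (poly_ext n A (xxT n) *\<^sub>v y_vec n)"

definition ideal_I :: "nat \<Rightarrow> rpoly set" where
  "ideal_I n = genideal (poly_ring (vars_xy n)) {\<Sum>i = 1..n. Var (X i) * Var (Y i)}"

text \<open>
  The substitution \<open>\<Psi>\<close>, for \<open>n \<ge> 2\<close>; only its values on \<open>vars_xy n\<close> matter.
\<close>

definition psi_y :: "nat \<Rightarrow> nat \<Rightarrow> rpoly" where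
  "psi_y n i =
     (if i = 1 then Var (Alpha 1) * Var (X 2)
      else if i = n then - (Var (Alpha (n - 1)) * Var (X (n - 1)))
      else Var (Alpha i) * Var (X (i + 1)) - Var (Alpha (i - 1)) * Var (X (i - 1)))"

fun Psi :: "nat \<Rightarrow> var \<Rightarrow> rpoly" where
  "Psi n (X i) = Var (X i)"
| "Psi n (Y i) = psi_y n i"
| "Psi n (Alpha i) = Var (Alpha i)"

definition q_poly :: "nat \<Rightarrow> (real mat \<Rightarrow> real mat) \<Rightarrow> rpoly" where
  "q_poly n A = subst (Psi n) (p_poly n A)"


section \<open>Sums of squares\<close>

definition sos_mod :: "var set \<Rightarrow> rpoly set \<Rightarrow> rpoly \<Rightarrow> bool" where
  "sos_mod V J p \<longleftrightarrow>
     (\<exists>(k::nat) f. (\<forall>i\<in>{1..k}. f i \<in> polys V) \<and> p - (\<Sum>i = 1..k. (f i)\<^sup>2) \<in> J)"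

definition sos :: "var set \<Rightarrow> rpoly \<Rightarrow> bool" where
  "sos V p \<longleftrightarrow> (\<exists>(k::nat) f. (\<forall>i\<in>{1..k}. f i \<in> polys V) \<and> p = (\<Sum>i = 1..k. (f i)\<^sup>2))"

end

theory Submission
  imports Defs "HOL-Computational_Algebra.Polynomial"
begin

text \<open>
  A linear map \<open>B\<close> on matrices is given by its Choi array \<open>\<beta> i j r s = B(E\<^sub>i\<^sub>j)\<^sub>r\<^sub>s\<close>. A positive
  semidefinite matrix is a sum of rank-one matrices, and \<open>\<langle>U,V\<rangle> = 0\<close> makes every rank-one summand
  of \<open>U\<close> orthogonal to every one of \<open>V\<close>. For rank-one \<open>U = uu\<^sup>T\<close>, \<open>V = vv\<^sup>T\<close>, put
  \<open>z = \<Sum>\<^sub>a u\<^sub>a v\<^sub>a\<^sup>T\<close>, where \<open>u\<^sub>a\<close>, \<open>v\<^sub>a\<close> are the blocks of \<open>u\<close>, \<open>v\<close>. Then \<open>\<langle>(I \<otimes> B)(U),V\<rangle>\<close> is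
  the Choi form \<open>\<Sum> \<beta> i j r s z\<^sub>i\<^sub>r z\<^sub>j\<^sub>s\<close>, and \<open>u \<bullet> v\<close> is the trace of \<open>z\<close>.
  Hence a \<open>*\<close>-linear map is completely cross-positive if and only if its Choi form is nonnegative on
  matrices of trace zero (\<open>choi_form_nonneg_of_ccp\<close>, \<open>ccp_choi_map\<close>).

  (i) implies (ii): a quadratic form that is nonnegative on the hyperplane \<open>w = 0\<close> is a sum of squares
  of linear forms plus a multiple of \<open>w\<close> (\<open>gram_modulo_vector\<close>). Here \<open>w\<close> is the trace; inserting
  \<open>z = xy\<^sup>T\<close> turns the Choi form into \<open>p\<^sub>A\<close> and the trace into \<open>\<Sum> x\<^sub>i y\<^sub>i\<close>.

  (ii) implies (iii): the vector \<open>y(x,\<alpha>)\<close> that \<open>\<Psi>\<close> substitutes for \<open>y\<close> is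
  \<open>\<Sum>\<^sub>k \<alpha>\<^sub>k (x\<^sub>k\<^sub>+\<^sub>1 e\<^sub>k - x\<^sub>k e\<^sub>k\<^sub>+\<^sub>1)\<close>, which is orthogonal to \<open>x\<close>. So \<open>\<Psi>\<close> kills the ideal.

  (iii) implies (i): let \<open>q\<^sub>A = \<Sum> q\<^sub>l\<^sup>2\<close>. Growth in \<open>x\<close> and in \<open>\<alpha>\<close> forces each \<open>q\<^sub>l\<close> to be linear in
  \<open>\<alpha>\<close> and quadratic in \<open>x\<close> (\<open>bihomogeneous_of_square_bound\<close>). As \<open>q\<^sub>l\<close> vanishes wherever
  \<open>y(x,\<alpha>) = 0\<close>, it is a bilinear form \<open>x\<^sup>T c\<^sub>l y(x,\<alpha>)\<close> (\<open>bilinear_of_vanishing\<close>). The vectors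
  \<open>y(x,\<alpha>)\<close> fill the orthogonal complement of \<open>x\<close> if no coordinate of \<open>x\<close> is zero, so by density
  \<open>p\<^sub>A(x,y) = \<Sum> (x\<^sup>T c\<^sub>l y)\<^sup>2\<close> whenever \<open>x \<bullet> y = 0\<close>. The difference of the two sides, as a
  biquadratic form, then comes from a map \<open>U \<mapsto> K U + U K\<^sup>T\<close>
  (\<open>biq_vanishing_on_perp\<close>), so that on symmetric matrices
  \<open>A(U) = \<Sum> c\<^sub>l\<^sup>T U c\<^sub>l + K U + U K\<^sup>T\<close>. The right-hand side makes sense for every \<open>U\<close>, and its Choi
  form is a sum of squares plus a multiple of the trace.

  Indices of vectors and matrices start at 0 below, so \<open>x i\<close> is the value of the variable \<open>X (i + 1)\<close>.
\<close>

section \<open>Gram decompositions of quadratic forms\<close>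

text \<open>
  Symmetric Gaussian elimination, one index at a time. If the pivot \<open>Q s s\<close> is positive, its row is
  split off as a square and the Schur complement is still nonnegative, being the form evaluated where
  the square vanishes. If the pivot is zero, nonnegativity forces the whole row to be zero.
\<close>

lemma psd_gram:
  fixes Q :: "'a \<Rightarrow> 'a \<Rightarrow> real"
  assumes "finite S"
    and "\<And>i j. i \<in> S \<Longrightarrow> j \<in> S \<Longrightarrow> Q i j = Q j i"
    and "\<And>z. (\<Sum>i\<in>S. \<Sum>j\<in>S. Q i j * z i * z j) \<ge> 0"
  shows "\<exists>(N::nat) L. \<forall>i\<in>S. \<forall>j\<in>S. Q i j = (\<Sum>l<N. L l i * L l j)"
  using assms
proof (induction S arbitrary: Q rule: finite_induct)
  case empty
  then show ?case by auto
next
  case (insert s S)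
  note sym = insert.prems(1) and psd = insert.prems(2)
  have expand: "(\<Sum>i\<in>insert s S. \<Sum>j\<in>insert s S. Q i j * z i * z j) =
      Q s s * z s * z s + 2 * z s * (\<Sum>j\<in>S. Q s j * z j) + (\<Sum>i\<in>S. \<Sum>j\<in>S. Q i j * z i * z j)" for z
  proof -
    have "(\<Sum>i\<in>S. Q i s * z i * z s) = z s * (\<Sum>j\<in>S. Q s j * z j)"
      unfolding sum_distrib_left by (intro sum.cong) (auto simp: sym)
    moreover have "(\<Sum>j\<in>S. Q s j * z s * z j) = z s * (\<Sum>j\<in>S. Q s j * z j)"
      unfolding sum_distrib_left by (intro sum.cong) auto
    ultimately show ?thesis using insert.hyps by (simp add: sum.distrib)
  qed
  have cut: "(\<Sum>j\<in>S. g j * (if j = s then t else z j)) = (\<Sum>j\<in>S. g j * z j)" for g z and t :: real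
    using insert.hyps by (intro sum.cong) auto
  have cut2: "(\<Sum>i\<in>S. \<Sum>j\<in>S. g i j * (if i = s then t else z i) * (if j = s then t else z j))
      = (\<Sum>i\<in>S. \<Sum>j\<in>S. g i j * z i * z j)" for g z and t :: real
    using insert.hyps by (intro sum.cong) auto
  have ext: "0 \<le> Q s s * t * t + 2 * t * (\<Sum>j\<in>S. Q s j * z j) + (\<Sum>i\<in>S. \<Sum>j\<in>S. Q i j * z i * z j)" for z t
    using psd[of "\<lambda>j. if j = s then t else z j"] unfolding expand cut2 unfolding cut by simp
  show ?case
  proof (cases "Q s s = 0")
    case True
    have row: "Q s j = 0" if "j \<in> S" for j
    proof (rule ccontr)
      assume nz: "Q s j \<noteq> 0"
      \<comment> \<open>On the span of the indices \<open>s\<close> and \<open>j\<close> the form is affine in the \<open>s\<close>-coordinate, so it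
        would become negative.\<close>
      define z where "z = (\<lambda>i. if i = j then 1 else (0::real))"
      have 1: "(\<Sum>i\<in>S. g i * z i) = g j" for g
        using that insert.hyps(1) by (simp add: z_def if_distrib cong: if_cong)
      have "(\<Sum>i\<in>S. \<Sum>k\<in>S. Q i k * z i * z k) = (\<Sum>i\<in>S. (\<Sum>k\<in>S. Q i k * z k) * z i)"
        by (simp add: sum_distrib_left sum_distrib_right mult_ac)
      then have "(\<Sum>i\<in>S. \<Sum>k\<in>S. Q i k * z i * z k) = Q j j" by (simp add: 1)
      then have "0 \<le> 2 * t * Q s j + Q j j" for t
        using ext[of t z] True 1[of "Q s"] by simp
      from this[of "- (Q j j + 1) / (2 * Q s j)"] nz show False by (simp add: field_simps)
    qed
    have "\<And>z. (\<Sum>i\<in>S. \<Sum>j\<in>S. Q i j * z i * z j) \<ge> 0"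
      using ext[of 0] by simp
    from insert.IH[OF _ this] sym obtain N :: nat and L
      where L: "\<forall>i\<in>S. \<forall>j\<in>S. Q i j = (\<Sum>l<N. L l i * L l j)" by auto
    show ?thesis
      by (rule exI[of _ N], rule exI[of _ "\<lambda>l i. if i = s then 0 else L l i"])
        (use True row L sym insert.hyps in \<open>auto intro!: sum.cong\<close>)
  next
    case False
    have "(\<Sum>j\<in>S. Q s j * 0) = 0" "0 \<le> Q s s"
      using ext[of 1 "\<lambda>_. 0"] by auto
    with False have pos: "Q s s > 0" by simp
    define R where "R i j = Q i j - Q s i * Q s j / Q s s" for i j
    have "0 \<le> (\<Sum>i\<in>S. \<Sum>j\<in>S. R i j * z i * z j)" for z
    proof -
      define b where "b = (\<Sum>j\<in>S. Q s j * z j)"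
      have "(\<Sum>i\<in>S. \<Sum>j\<in>S. R i j * z i * z j)
          = (\<Sum>i\<in>S. \<Sum>j\<in>S. Q i j * z i * z j) - b * b / Q s s"
        unfolding b_def sum_product sum_divide_distrib R_def
        by (simp add: sum_subtractf[symmetric] algebra_simps)
      also have "\<dots> = Q s s * (- b / Q s s) * (- b / Q s s) + 2 * (- b / Q s s) * b
          + (\<Sum>i\<in>S. \<Sum>j\<in>S. Q i j * z i * z j)"
        using pos by (simp add: field_simps)
      also have "\<dots> \<ge> 0" using ext[of "- b / Q s s" z] by (simp add: b_def)
      finally show ?thesis .
    qed
    from insert.IH[of R, OF _ this] sym obtain N :: nat and L
      where L: "\<forall>i\<in>S. \<forall>j\<in>S. R i j = (\<Sum>l<N. L l i * L l j)" by (auto simp: R_def mult.commute)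
    define L' where "L' l i = (if l = N then Q s i / sqrt (Q s s) else if i = s then 0 else L l i)" for l i
    have "Q i j = (\<Sum>l<Suc N. L' l i * L' l j)" if "i \<in> insert s S" "j \<in> insert s S" for i j
    proof -
      have sq: "Q s i / sqrt (Q s s) * (Q s j / sqrt (Q s s)) = Q s i * Q s j / Q s s"
        using pos by (simp add: field_simps)
      have "(\<Sum>l<N. L' l i * L' l j) = Q i j - Q s i * Q s j / Q s s"
      proof (cases "i = s \<or> j = s")
        case True
        then have "(\<Sum>l<N. L' l i * L' l j) = 0" by (intro sum.neutral) (auto simp: L'_def)
        then show ?thesis using True pos sym[of i j] that by auto
      next
        case False
        then have "(\<Sum>l<N. L' l i * L' l j) = (\<Sum>l<N. L l i * L l j)"
          by (intro sum.cong) (auto simp: L'_def)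
        then show ?thesis using False L that by (auto simp: R_def)
      qed
      then show ?thesis using sq by (simp add: L'_def)
    qed
    then show ?thesis by blast
  qed
qed

text \<open>
  With \<open>P\<close> the orthogonal projection along \<open>w\<close>, the form \<open>z \<mapsto> C(Pz, Pz)\<close> is nonnegative everywhere
  and differs from \<open>C\<close> by a symmetric product of \<open>w\<close> with a vector \<open>g\<close>.
\<close>

lemma gram_modulo_vector:
  fixes C :: "'a \<Rightarrow> 'a \<Rightarrow> real"
  assumes fin: "finite S"
    and sym: "\<And>i j. i \<in> S \<Longrightarrow> j \<in> S \<Longrightarrow> C i j = C j i"
    and w: "(\<Sum>i\<in>S. w i * w i) \<noteq> 0"
    and psd: "\<And>z. (\<Sum>i\<in>S. w i * z i) = 0 \<Longrightarrow> (\<Sum>i\<in>S. \<Sum>j\<in>S. C i j * z i * z j) \<ge> 0"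
  shows "\<exists>(N::nat) L g. \<forall>i\<in>S. \<forall>j\<in>S. C i j = (\<Sum>l<N. L l i * L l j) + w i * g j + g i * w j"
proof -
  define N where "N = (\<Sum>i\<in>S. w i * w i)"
  define c where "c i = (\<Sum>j\<in>S. C i j * w j)" for i
  define e where "e = (\<Sum>i\<in>S. c i * w i)"
  \<comment> \<open>The vector for which \<open>C - w g\<^sup>T - g w\<^sup>T\<close> is \<open>P\<^sup>T C P\<close>.\<close>
  define g where "g i = c i / N - e / (2 * N * N) * w i" for i
  define Q where "Q i j = C i j - w i * g j - g i * w j" for i j
  have "0 \<le> (\<Sum>i\<in>S. \<Sum>j\<in>S. Q i j * z i * z j)" for z
  proof -
    define t where "t = (\<Sum>i\<in>S. w i * z i) / N"
    have tN: "(\<Sum>i\<in>S. w i * z i) = t * N" using w by (simp add: t_def N_def)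
    define d where "d = (\<Sum>i\<in>S. c i * z i)"
    define q where "q = (\<Sum>i\<in>S. \<Sum>j\<in>S. C i j * z i * z j)"
    have "(\<Sum>i\<in>S. w i * (z i - t * w i)) = (\<Sum>i\<in>S. w i * z i) - t * N"
      by (simp add: N_def algebra_simps sum_subtractf sum_distrib_left)
    then have "0 \<le> (\<Sum>i\<in>S. \<Sum>j\<in>S. C i j * (z i - t * w i) * (z j - t * w j))"
      by (intro psd) (simp add: tN)
    also have "\<dots> = q - t * (\<Sum>i\<in>S. \<Sum>j\<in>S. C i j * z i * w j)
        - t * (\<Sum>i\<in>S. \<Sum>j\<in>S. C i j * w i * z j) + t * t * (\<Sum>i\<in>S. \<Sum>j\<in>S. C i j * w i * w j)"
      by (simp add: q_def algebra_simps sum_subtractf sum.distrib sum_distrib_left)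
    also have "(\<Sum>i\<in>S. \<Sum>j\<in>S. C i j * z i * w j) = d"
      by (simp add: d_def c_def sum_distrib_left sum_distrib_right algebra_simps)
    also have "(\<Sum>i\<in>S. \<Sum>j\<in>S. C i j * w i * z j) = (\<Sum>j\<in>S. \<Sum>i\<in>S. C i j * w i * z j)"
      by (rule sum.swap)
    also have "\<dots> = d"
      unfolding d_def c_def sum_distrib_right by (intro sum.cong refl) (simp add: sym)
    also have "(\<Sum>i\<in>S. \<Sum>j\<in>S. C i j * w i * w j) = e"
      by (simp add: e_def c_def sum_distrib_left sum_distrib_right algebra_simps)
    finally have *: "0 \<le> q - t * d - t * d + t * t * e" .
    have gz: "(\<Sum>i\<in>S. g i * z i) = d / N - e / (2 * N) * t"
    proof -
      have "(\<Sum>i\<in>S. g i * z i) = d / N - e / (2 * N * N) * (\<Sum>i\<in>S. w i * z i)"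
        by (simp add: g_def d_def algebra_simps sum_subtractf sum_distrib_left sum_divide_distrib)
      then show ?thesis using w by (simp add: tN N_def[symmetric])
    qed
    have "(\<Sum>i\<in>S. \<Sum>j\<in>S. Q i j * z i * z j) = q - (\<Sum>i\<in>S. w i * z i) * (\<Sum>i\<in>S. g i * z i)
        - (\<Sum>i\<in>S. g i * z i) * (\<Sum>i\<in>S. w i * z i)"
      unfolding Q_def q_def sum_product by (simp add: algebra_simps sum_subtractf sum.distrib)
    also have "\<dots> = q - t * d - t * d + t * t * e"
      using w unfolding gz tN N_def[symmetric] by (simp add: field_simps)
    finally show ?thesis using * by simp
  qed
  from psd_gram[OF fin _ this] sym obtain K :: nat and L
    where "\<forall>i\<in>S. \<forall>j\<in>S. Q i j = (\<Sum>l<K. L l i * L l j)" by (auto simp: Q_def)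
  then show ?thesis
    by (intro exI[of _ K] exI[of _ L] exI[of _ g]) (auto simp: Q_def algebra_simps)
qed

section \<open>The vectors orthogonal to x\<close>

definition lin :: "nat \<Rightarrow> (nat \<Rightarrow> real) \<Rightarrow> (nat \<Rightarrow> real) \<Rightarrow> real" where
  "lin n c x = (\<Sum>i<n. c i * x i)"

definition quad :: "nat \<Rightarrow> (nat \<Rightarrow> nat \<Rightarrow> real) \<Rightarrow> (nat \<Rightarrow> real) \<Rightarrow> real" where
  "quad n F x = (\<Sum>i<n. \<Sum>j<n. F i j * x i * x j)"

text \<open>
  The vector \<open>y\<close> of the substitution \<open>\<Psi>\<close>, evaluated at real numbers and with all indices lowered by one.
\<close>

definition perp_vec :: "nat \<Rightarrow> (nat \<Rightarrow> real) \<Rightarrow> (nat \<Rightarrow> real) \<Rightarrow> nat \<Rightarrow> real" where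
  "perp_vec n x \<alpha> r = (if r + 1 < n then \<alpha> r * x (r + 1) else 0) - (if 0 < r then \<alpha> (r - 1) * x (r - 1) else 0)"

lemma lin_add_arg: "lin n c (\<lambda>i. x i + y i) = lin n c x + lin n c y"
  and lin_diff: "lin n (\<lambda>i. c i - d i) x = lin n c x - lin n d x"
  and lin_uminus: "lin n (\<lambda>i. - c i) x = - lin n c x"
  by (simp_all add: lin_def algebra_simps sum.distrib sum_subtractf sum_negf)

lemma lin_unit: "k < n \<Longrightarrow> lin n c (\<lambda>i. if i = k then t else 0) = c k * t"
  by (simp add: lin_def if_distrib cong: if_cong)

lemma lin_single: "k < n \<Longrightarrow> lin n (\<lambda>i. if i = k then t else 0) x = t * x k"
  by (simp add: lin_def if_distrib[of "\<lambda>u. u * _"] cong: if_cong)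

text \<open>
  Every monomial of such a form contains \<open>x k\<close> or \<open>x l\<close>; collect the coefficients accordingly.
\<close>

lemma quad_vanishing_on_codim2:
  assumes kl: "k < n" "l < n" "k \<noteq> l"
    and van: "\<And>x. x k = 0 \<Longrightarrow> x l = 0 \<Longrightarrow> quad n F x = 0"
  shows "\<exists>g h. \<forall>x. quad n F x = x l * lin n g x + x k * lin n h x"
proof -
  define P where "P = {k, l}"
  define row where "row i j = F i j + (if j \<in> P then 0 else F j i)" for i j
  have "quad n F x = x l * lin n (row l) x + x k * lin n (row k) x" for x
  proof -
    define u where "u i = (if i \<in> P then 0 else x i)" for i
    have split: "(\<Sum>i<n. g i) = g k + g l + (\<Sum>i<n. if i \<in> P then 0 else g i)" for g :: "nat \<Rightarrow> real"
    proof -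
      have "(\<Sum>i<n. g i) = (\<Sum>i<n. (if i = k then g k else 0) + ((if i = l then g l else 0)
          + (if i \<in> P then 0 else g i)))"
        using kl by (intro sum.cong) (auto simp: P_def)
      then show ?thesis using kl by (simp add: sum.distrib)
    qed
    \<comment> \<open>The sum over all pairs splits into the rows \<open>k\<close>, \<open>l\<close>, the rest of the columns \<open>k\<close>, \<open>l\<close>, and
      a remainder that is the form at a point with \<open>x k = x l = 0\<close>.\<close>
    have "quad n F x = (\<Sum>j<n. F k j * x k * x j) + (\<Sum>j<n. F l j * x l * x j)
        + (\<Sum>i<n. \<Sum>j<n. if i \<in> P then 0 else F i j * x i * x j)"
      unfolding quad_def by (subst split) (auto intro!: sum.cong)
    also have "(\<Sum>i<n. \<Sum>j<n. if i \<in> P then 0 else F i j * x i * x j)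
        = (\<Sum>i<n. if i \<in> P then 0 else F i k * x i * x k)
        + (\<Sum>i<n. if i \<in> P then 0 else F i l * x i * x l)
        + (\<Sum>i<n. \<Sum>j<n. F i j * u i * u j)"
      by (subst split) (auto simp: sum.distrib u_def intro!: arg_cong2[of _ _ _ _ "(+)"] sum.cong)
    also have "(\<Sum>i<n. \<Sum>j<n. F i j * u i * u j) = 0"
      using van[of u] by (simp add: quad_def u_def P_def)
    also have "(\<Sum>j<n. F k j * x k * x j) + (\<Sum>j<n. F l j * x l * x j)
        + ((\<Sum>i<n. if i \<in> P then 0 else F i k * x i * x k)
          + (\<Sum>i<n. if i \<in> P then 0 else F i l * x i * x l) + 0)
        = x l * lin n (row l) x + x k * lin n (row k) x"
    proof -
      have "x k * lin n (row k) x
          = (\<Sum>j<n. F k j * x k * x j) + (\<Sum>i<n. if i \<in> P then 0 else F i k * x i * x k)" for k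
        unfolding lin_def sum_distrib_left sum.distrib[symmetric]
        by (intro sum.cong) (auto simp: row_def algebra_simps)
      then show ?thesis by simp
    qed
    finally show ?thesis .
  qed
  then show ?thesis by blast
qed

text \<open>
  A form that is linear in \<open>\<alpha>\<close> and quadratic in \<open>x\<close> is bilinear in \<open>x\<close> and \<open>perp_vec n x \<alpha>\<close> as soon as
  it vanishes with the latter. Comparing coefficients of \<open>\<alpha>\<close>, one needs linear forms \<open>C\<^sub>k\<close> with
  \<open>F\<^sub>k = x\<^sub>k\<^sub>+\<^sub>1 C\<^sub>k - x\<^sub>k C\<^sub>k\<^sub>+\<^sub>1\<close>, where consecutive equations share a \<open>C\<^sub>k\<close>. Each \<open>F\<^sub>k\<close>
  has some representation of this kind because it vanishes for \<open>x\<^sub>k = x\<^sub>k\<^sub>+\<^sub>1 = 0\<close>. The \<open>C\<^sub>k\<close> inherited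
  from \<open>F\<^sub>k\<^sub>-\<^sub>1\<close> fits because, for \<open>x\<^sub>k = 0\<close>, the parameter
  \<open>\<alpha> = x\<^sub>k\<^sub>+\<^sub>1 e\<^sub>k\<^sub>-\<^sub>1 + x\<^sub>k\<^sub>-\<^sub>1 e\<^sub>k\<close> gives the zero vector, which relates \<open>F\<^sub>k\<^sub>-\<^sub>1\<close> to \<open>F\<^sub>k\<close>.
\<close>

lemma bilinear_of_vanishing:
  assumes van: "\<And>x \<alpha>. (\<And>r. r < n \<Longrightarrow> perp_vec n x \<alpha> r = 0) \<Longrightarrow> (\<Sum>k<n-1. \<alpha> k * quad n (F k) x) = 0"
  shows "\<exists>c. \<forall>x \<alpha>. (\<Sum>k<n-1. \<alpha> k * quad n (F k) x) = (\<Sum>i<n. \<Sum>r<n. c i r * x i * perp_vec n x \<alpha> r)"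
proof -
  have van1: "quad n (F k) x = 0" if "k < n - 1" "x k = 0" "x (k + 1) = 0" for k x
  proof -
    have "(\<Sum>j<n-1. (if j = k then 1 else 0) * quad n (F j) x) = 0"
      by (rule van) (use that in \<open>auto simp: perp_vec_def\<close>)
    then show ?thesis using that by (simp add: if_distrib[of "\<lambda>u. u * _"] cong: if_cong)
  qed
  have van2: "x (k + 2) * quad n (F k) x + x k * quad n (F (k + 1)) x = 0"
    if "k + 1 < n - 1" "x (k + 1) = 0" for k x
  proof -
    define \<alpha> where "\<alpha> j = (if j = k then x (k + 2) else 0) + (if j = k + 1 then x k else 0)" for j
    have "(\<Sum>j<n-1. \<alpha> j * quad n (F j) x) = 0"
      by (rule van) (use that in \<open>auto simp: perp_vec_def \<alpha>_def\<close>)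
    then show ?thesis using that
      by (simp add: \<alpha>_def distrib_right sum.distrib if_distrib[of "\<lambda>u. u * _"] cong: if_cong)
  qed
  have "\<exists>C. \<forall>k<m. \<forall>x. quad n (F k) x = x (k + 1) * lin n (C k) x - x k * lin n (C (k + 1)) x"
    if "m \<le> n - 1" for m
    using that
  proof (induction m)
    case 0
    then show ?case by simp
  next
    case (Suc m)
    then obtain C where C: "\<And>k x. k < m \<Longrightarrow> quad n (F k) x = x (k + 1) * lin n (C k) x - x k * lin n (C (k + 1)) x"
      by auto
    have m: "m < n - 1" "m < n" "m + 1 < n" using Suc.prems by auto
    obtain g h where gh: "\<And>x. quad n (F m) x = x (m + 1) * lin n g x + x m * lin n h x"
      using quad_vanishing_on_codim2[of m n "m + 1" "F m"] m van1[of m] by auto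
    obtain e where e: "\<And>x. quad n (F m) x = x (m + 1) * lin n (if m = 0 then g else C m) x - x m * lin n e x"
    proof (cases m)
      case 0
      show ?thesis by (rule that[of "\<lambda>i. - h i"]) (use 0 gh in \<open>simp add: lin_uminus\<close>)
    next
      case (Suc p)
      \<comment> \<open>The first coefficient \<open>g\<close> of \<open>F m\<close> agrees with the inherited \<open>C m\<close> up to a multiple of
        \<open>x m\<close>, and that multiple can be moved to the second coefficient.\<close>
      define d where "d i = g i - C m i" for i
      have dz: "lin n d x = 0" if "x m = 0" "x p \<noteq> 0" "x (m + 1) \<noteq> 0" for x
      proof -
        have "x (m + 1) * (- (x p * lin n (C m) x)) + x p * (x (m + 1) * lin n g x) = 0"
          using van2[of p x] that m Suc C[of p x] gh[of x] by simp
        then have "x (m + 1) * x p * lin n d x = 0"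
          by (simp add: d_def[abs_def] lin_diff algebra_simps)
        then show ?thesis using that by simp
      qed
      have d0: "d i = 0" if "i < n" "i \<noteq> m" for i
      proof -
        \<comment> \<open>The condition on \<open>x p\<close> and \<open>x (m + 1)\<close> is open, so \<open>d\<close> vanishes on the whole hyperplane
          \<open>x m = 0\<close>: compare a base point with a shift of it by a unit vector.\<close>
        define b where "b j = (if j = p \<or> j = m + 1 then 1 else (0::real))" for j
        have "lin n d b = 0" by (rule dz) (auto simp: b_def Suc)
        moreover have "lin n d (\<lambda>j. b j + (if j = i then 1 else 0)) = 0"
          by (rule dz) (use that in \<open>auto simp: b_def Suc\<close>)
        ultimately show ?thesis using that by (simp add: lin_add_arg lin_unit)
      qed
      have "lin n d x = d m * x m" for x
      proof -
        have "lin n d x = lin n (\<lambda>i. if i = m then d m else 0) x"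
          unfolding lin_def using d0 by (intro sum.cong) auto
        then show ?thesis using m by (simp add: lin_single)
      qed
      then have g: "lin n g x = lin n (C m) x + d m * x m" for x
        unfolding d_def[abs_def] lin_diff by (simp add: algebra_simps)
      show ?thesis
      proof (rule that[of "\<lambda>i. (- h i) - (if i = m + 1 then d m else 0)"])
        fix x
        show "quad n (F m) x = x (m + 1) * lin n (if m = 0 then g else C m) x
            - x m * lin n (\<lambda>i. (- h i) - (if i = m + 1 then d m else 0)) x"
          using m Suc unfolding gh lin_diff g by (simp add: lin_single lin_uminus algebra_simps)
      qed
    qed
    define C' where "C' j = (if j = m + 1 then e else if j = 0 \<and> m = 0 then g else C j)" for j
    have "quad n (F k) x = x (k + 1) * lin n (C' k) x - x k * lin n (C' (k + 1)) x" if "k < Suc m" for k x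
      using that C[of k x] e[of x] by (cases "k = m") (auto simp: C'_def)
    then show ?case by blast
  qed
  then obtain C where C: "\<And>k x. k < n - 1 \<Longrightarrow> quad n (F k) x = x (k + 1) * lin n (C k) x - x k * lin n (C (k + 1)) x"
    by blast
  have "(\<Sum>k<n-1. \<alpha> k * quad n (F k) x) = (\<Sum>i<n. \<Sum>r<n. C r i * x i * perp_vec n x \<alpha> r)" for x \<alpha>
  proof -
    have "(\<Sum>i<n. \<Sum>r<n. C r i * x i * perp_vec n x \<alpha> r) = (\<Sum>r<n. perp_vec n x \<alpha> r * lin n (C r) x)"
      by (subst sum.swap) (simp add: lin_def sum_distrib_left algebra_simps)
    also have "\<dots> = (\<Sum>r<n. if r + 1 < n then \<alpha> r * x (r + 1) * lin n (C r) x else 0)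
        - (\<Sum>r<n. if 0 < r then \<alpha> (r - 1) * x (r - 1) * lin n (C r) x else 0)"
      unfolding sum_subtractf[symmetric] by (intro sum.cong) (auto simp: perp_vec_def algebra_simps)
    also have "(\<Sum>r<n. if r + 1 < n then \<alpha> r * x (r + 1) * lin n (C r) x else 0)
        = (\<Sum>k<n-1. \<alpha> k * x (k + 1) * lin n (C k) x)"
      by (cases n) auto
    also have "(\<Sum>r<n. if 0 < r then \<alpha> (r - 1) * x (r - 1) * lin n (C r) x else 0)
        = (\<Sum>k<n-1. \<alpha> k * x k * lin n (C (k + 1)) x)"
      by (cases n) (auto simp: sum.lessThan_Suc_shift simp del: sum.lessThan_Suc)
    also have "(\<Sum>k<n-1. \<alpha> k * x (k + 1) * lin n (C k) x) - (\<Sum>k<n-1. \<alpha> k * x k * lin n (C (k + 1)) x)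
        = (\<Sum>k<n-1. \<alpha> k * quad n (F k) x)"
      unfolding sum_subtractf[symmetric] by (intro sum.cong) (auto simp: C algebra_simps)
    finally show ?thesis by simp
  qed
  then show ?thesis by (intro exI[of _ "\<lambda>i r. C r i"]) simp
qed

text \<open>
  Multiplying the equation for the coordinate \<open>r\<close> by \<open>x r\<close> makes the system telescope:
  \<open>\<alpha> r * x r * x (r + 1)\<close> has to be the partial sum of \<open>x i * y i\<close> up to \<open>r\<close>. The last equation is
  solvable because the total sum is zero.
\<close>

lemma perp_vec_surj:
  assumes n: "n \<ge> 2" and nz: "\<And>i. i < n \<Longrightarrow> x i \<noteq> 0" and perp: "(\<Sum>i<n. x i * y i) = 0"
  shows "\<exists>\<alpha>. \<forall>r<n. perp_vec n x \<alpha> r = y r"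
proof -
  define \<alpha> where "\<alpha> k = (\<Sum>i\<le>k. x i * y i) / (x k * x (k + 1))" for k
  have "perp_vec n x \<alpha> r = y r" if r: "r < n" for r
  proof -
    have low: "x r * (if 0 < r then \<alpha> (r - 1) * x (r - 1) else 0) = (\<Sum>i<r. x i * y i)"
      using nz[of r] nz[of "r - 1"] r by (cases r) (auto simp: \<alpha>_def lessThan_Suc_atMost)
    have high: "x r * (if r + 1 < n then \<alpha> r * x (r + 1) else 0) = (\<Sum>i<Suc r. x i * y i)"
    proof (cases "r + 1 < n")
      case True
      then show ?thesis using nz[of r] nz[of "r + 1"] r by (simp add: \<alpha>_def lessThan_Suc_atMost)
    next
      case False
      with r have "Suc r = n" by simp
      then show ?thesis using perp False by simp
    qed
    have "x r * perp_vec n x \<alpha> r = x r * y r"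
      unfolding perp_vec_def right_diff_distrib low high by simp
    then show ?thesis using nz[OF r] by simp
  qed
  then show ?thesis by blast
qed

section \<open>Biquadratic forms vanishing on orthogonal pairs\<close>

definition biq :: "nat \<Rightarrow> (nat \<Rightarrow> nat \<Rightarrow> nat \<Rightarrow> nat \<Rightarrow> real) \<Rightarrow> (nat \<Rightarrow> real) \<Rightarrow> (nat \<Rightarrow> real) \<Rightarrow> real" where
  "biq n d x y = (\<Sum>i<n. \<Sum>j<n. \<Sum>r<n. \<Sum>s<n. d i j r s * x i * x j * y r * y s)"

lemma biq_scale: "biq n d x (\<lambda>r. t * y r) = t\<^sup>2 * biq n d x y"
  by (simp add: biq_def sum_distrib_left power2_eq_square algebra_simps)

lemma biq_scale_left: "biq n d (\<lambda>i. t * x i) y = t\<^sup>2 * biq n d x y"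
  by (simp add: biq_def sum_distrib_left power2_eq_square algebra_simps)

lemma biq_add: "biq n (\<lambda>i j r s. d i j r s + e i j r s) x y = biq n d x y + biq n e x y"
  and biq_diff: "biq n (\<lambda>i j r s. d i j r s - e i j r s) x y = biq n d x y - biq n e x y"
  and biq_cmult: "biq n (\<lambda>i j r s. t * d i j r s) x y = t * biq n d x y"
  by (simp_all add: biq_def distrib_right left_diff_distrib sum.distrib sum_subtractf
      sum_distrib_left mult.assoc)

text \<open>
  Approximate \<open>x\<close> by \<open>x + e\<close> (in each coordinate) and \<open>y\<close> by its projection onto the complement of
  that vector. The projection is multiplied by the squared norm, which keeps it polynomial in \<open>e\<close>.
\<close>

lemma biq_vanishes_by_density:
  assumes van: "\<And>x y. (\<And>i. i < n \<Longrightarrow> x i \<noteq> 0) \<Longrightarrow> (\<Sum>i<n. x i * y i) = 0 \<Longrightarrow> biq n d x y = 0"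
    and perp: "(\<Sum>i<n. x i * y i) = 0"
  shows "biq n d x y = 0"
proof (cases "(\<Sum>i<n. x i * x i) = 0")
  case True
  then have "x i = 0" if "i < n" for i
    using that by (simp add: sum_nonneg_eq_0_iff)
  then show ?thesis by (simp add: biq_def)
next
  case False
  define N where "N e = (\<Sum>i<n. (x i + e) * (x i + e))" for e
  define s where "s e = (\<Sum>i<n. (x i + e) * y i)" for e
  define u where "u e r = N e * y r - s e * (x r + e)" for e r
  have lim: "((\<lambda>e. biq n d (\<lambda>i. x i + e) (u e)) \<longlongrightarrow> biq n d (\<lambda>i. x i + 0) (u 0)) (at 0)"
    unfolding biq_def u_def N_def s_def by (intro tendsto_intros)
  have "\<forall>\<^sub>F e in at 0. biq n d (\<lambda>i. x i + e) (u e) = 0"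
  proof -
    have "\<forall>\<^sub>F e in at 0. \<forall>i\<in>{..<n}. x i + e \<noteq> 0"
    proof (intro eventually_ball_finite ballI)
      fix i
      show "\<forall>\<^sub>F e in at 0. x i + e \<noteq> 0"
      proof (cases "x i = 0")
        case True
        then show ?thesis by (simp add: eventually_at_filter)
      next
        case False
        have "((\<lambda>e. x i + e) \<longlongrightarrow> x i + 0) (at 0)" by (intro tendsto_intros)
        then show ?thesis using False by (intro tendsto_imp_eventually_ne) auto
      qed
    qed simp
    then show ?thesis
    proof (rule eventually_mono)
      fix e assume nz: "\<forall>i\<in>{..<n}. x i + e \<noteq> 0"
      have "(\<Sum>i<n. (x i + e) * u e i)
          = (\<Sum>i<n. N e * ((x i + e) * y i) - s e * ((x i + e) * (x i + e)))"
        by (simp add: u_def algebra_simps)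
      also have "\<dots> = N e * s e - s e * N e"
        unfolding sum_subtractf sum_distrib_left[symmetric] by (simp add: N_def s_def)
      finally have "(\<Sum>i<n. (x i + e) * u e i) = 0" by simp
      then show "biq n d (\<lambda>i. x i + e) (u e) = 0" using nz by (intro van) auto
    qed
  qed
  then have "((\<lambda>e. biq n d (\<lambda>i. x i + e) (u e)) \<longlongrightarrow> 0) (at 0)"
    by (rule tendsto_eventually)
  then have "biq n d (\<lambda>i. x i + 0) (u 0) = 0"
    by (rule tendsto_unique[OF at_neq_bot lim])
  moreover have "u 0 = (\<lambda>r. N 0 * y r)" using perp by (simp add: u_def s_def fun_eq_iff)
  ultimately have "(N 0)\<^sup>2 * biq n d x y = 0" by (simp add: biq_scale)
  then show ?thesis using False by (simp add: N_def)
qed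

lemma quad_two_point:
  assumes "i < n" "j < n"
  shows "quad n G (\<lambda>a. (if a = i then s else 0) + (if a = j then t else 0))
    = s * s * G i i + s * t * (G i j + G j i) + t * t * G j j"
proof -
  have "(\<Sum>b<n. c b * ((if b = i then s else 0) + (if b = j then t else 0))) = c i * s + c j * t" for c
    using assms by (simp add: distrib_left sum.distrib if_distrib[of "(*) _"] cong: if_cong)
  note inner = this
  have "quad n G (\<lambda>a. (if a = i then s else 0) + (if a = j then t else 0))
    = (\<Sum>a<n. (\<Sum>b<n. G a b * ((if b = i then s else 0) + (if b = j then t else 0)))
         * ((if a = i then s else 0) + (if a = j then t else 0)))"
    unfolding quad_def sum_distrib_right by (intro sum.cong refl) (simp only: mult_ac)
  also have "\<dots> = (\<Sum>a<n. (G a i * s + G a j * t) * ((if a = i then s else 0) + (if a = j then t else 0)))"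
    by (simp only: inner)
  also have "\<dots> = (G i i * s + G i j * t) * s + (G j i * s + G j j * t) * t"
    by (rule inner)
  finally show ?thesis by (simp add: algebra_simps)
qed

lemma quad_one_point: "i < n \<Longrightarrow> quad n G (\<lambda>a. if a = i then s else 0) = s * s * G i i"
  using quad_two_point[of i n i G s 0] by simp

lemma quad_add_scaled:
  "quad n G (\<lambda>a. y a + t * p a)
    = quad n G y + t * (\<Sum>a<n. \<Sum>b<n. G a b * (y a * p b + p a * y b)) + t * t * quad n G p"
  by (simp add: quad_def sum_distrib_left sum.distrib algebra_simps)

text \<open>
  Moving any \<open>y\<close> along the all-ones vector reaches points with \<open>y i \<noteq> 0\<close> and \<open>y j \<noteq> 0\<close> at all large
  times. The form is a polynomial of degree at most two in the time, so it vanishes also at time 0.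
\<close>

lemma quad_generic_zero:
  assumes sym: "\<And>a b. a < n \<Longrightarrow> b < n \<Longrightarrow> G a b = G b a"
    and van: "\<And>y. y i \<noteq> 0 \<Longrightarrow> y j \<noteq> 0 \<Longrightarrow> quad n G y = 0"
    and rs: "r < n" "s < n"
  shows "G r s = 0"
proof -
  have zero: "quad n G y = 0" for y
  proof -
    define p :: "nat \<Rightarrow> real" where "p = (\<lambda>_. 1)"
    define b where "b = (\<Sum>u<n. \<Sum>v<n. G u v * (y u * p v + p u * y v))"
    define q where "q = quad n G p"
    define T where "T = \<bar>y i\<bar> + \<bar>y j\<bar> + 1"
    have "quad n G y + t * b + t * t * q = 0" if "t \<ge> T" for t
      unfolding b_def q_def quad_add_scaled[symmetric]
      by (rule van) (use that in \<open>auto simp: T_def p_def\<close>)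
    from this[of T] this[of "T + 1"] this[of "T + 2"]
    have eqs: "quad n G y + T * b + T * T * q = 0"
      "quad n G y + (T + 1) * b + (T + 1) * (T + 1) * q = 0"
      "quad n G y + (T + 2) * b + (T + 2) * (T + 2) * q = 0" by auto
    then have "q = 0" by (simp add: algebra_simps)
    moreover from this eqs have "b = 0" by (simp add: algebra_simps)
    ultimately show ?thesis using eqs by simp
  qed
  have "G u u = 0" if "u < n" for u
    using zero[of "\<lambda>a. if a = u then 1 else 0"] that by (simp add: quad_one_point)
  then show ?thesis
    using zero[of "\<lambda>a. (if a = r then 1 else 0) + (if a = s then 1 else 0)"] rs sym[OF rs]
      quad_two_point[of r n s G 1 1] by simp
qed

definition delta :: "nat \<Rightarrow> nat \<Rightarrow> real" where
  "delta i j = (if i = j then 1 else 0)"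

text \<open>
  The Choi array of the Lyapunov map \<open>U \<mapsto> K U + U K\<^sup>T\<close>, where \<open>K\<close> has the entry \<open>\<kappa> i r\<close> in row \<open>r\<close> and
  column \<open>i\<close>.
\<close>

definition lyap :: "(nat \<Rightarrow> nat \<Rightarrow> real) \<Rightarrow> nat \<Rightarrow> nat \<Rightarrow> nat \<Rightarrow> nat \<Rightarrow> real" where
  "lyap \<kappa> i j r s = \<kappa> i r * delta j s + delta i r * \<kappa> j s"

lemma biq_eq_quad: "biq n d x y = quad n (\<lambda>i j. quad n (d i j) y) x"
  by (simp add: biq_def quad_def sum_distrib_left sum_distrib_right mult_ac)

lemma biq_swap: "biq n (\<lambda>i j. d j i) x y = biq n d x y"
  unfolding biq_def by (subst sum.swap) (simp add: mult_ac)

text \<open>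
  The quadratic form of \<open>K xx\<^sup>T + xx\<^sup>T K\<^sup>T\<close> at \<open>y\<close> is \<open>2 (y\<^sup>T K x) (x\<^sup>T y)\<close>.
\<close>

lemma biq_lyap:
  "biq n (lyap \<kappa>) x y = 2 * (\<Sum>i<n. \<Sum>r<n. \<kappa> i r * x i * y r) * (\<Sum>i<n. x i * y i)"
proof -
  have 1: "(\<Sum>s<n. c s * delta j s * d s) = c j * d j" "(\<Sum>s<n. delta j s * c s) = c j" if "j < n" for j c d
    using that by (auto simp: delta_def if_distrib[of "\<lambda>u. u * _"] if_distrib[of "\<lambda>u. _ * u"] cong: if_cong)
  define S where "S = (\<Sum>i<n. \<Sum>r<n. \<kappa> i r * x i * y r)"
  have "(\<Sum>i<n. \<Sum>j<n. \<Sum>r<n. \<Sum>s<n. \<kappa> i r * delta j s * x i * x j * y r * y s)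
      = (\<Sum>i<n. \<Sum>j<n. (\<Sum>r<n. \<kappa> i r * x i * y r) * (\<Sum>s<n. delta j s * (x j * y s)))"
    unfolding sum_product by (simp only: mult_ac)
  also have "\<dots> = (\<Sum>i<n. \<Sum>j<n. (\<Sum>r<n. \<kappa> i r * x i * y r) * (x j * y j))"
    by (intro sum.cong refl) (simp add: 1)
  also have "\<dots> = S * (\<Sum>i<n. x i * y i)"
    unfolding S_def sum_product ..
  finally have A: "(\<Sum>i<n. \<Sum>j<n. \<Sum>r<n. \<Sum>s<n. \<kappa> i r * delta j s * x i * x j * y r * y s)
      = S * (\<Sum>i<n. x i * y i)" .
  have "(\<Sum>i<n. \<Sum>j<n. \<Sum>r<n. \<Sum>s<n. delta i r * \<kappa> j s * x i * x j * y r * y s)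
      = (\<Sum>i<n. \<Sum>j<n. \<Sum>r<n. delta i r * (y r * (\<Sum>s<n. \<kappa> j s * x i * x j * y s)))"
    by (simp add: sum_distrib_left sum_distrib_right mult_ac)
  also have "\<dots> = (\<Sum>i<n. \<Sum>j<n. x i * y i * (\<Sum>s<n. \<kappa> j s * x j * y s))"
  proof (intro sum.cong refl)
    fix i j assume i: "i \<in> {..<n}"
    have "(\<Sum>r<n. delta i r * (y r * (\<Sum>s<n. \<kappa> j s * x i * x j * y s)))
        = y i * (\<Sum>s<n. \<kappa> j s * x i * x j * y s)"
      by (rule 1(2)) (use i in simp)
    then show "(\<Sum>r<n. delta i r * (y r * (\<Sum>s<n. \<kappa> j s * x i * x j * y s)))
        = x i * y i * (\<Sum>s<n. \<kappa> j s * x j * y s)"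
      by (simp add: sum_distrib_left mult_ac)
  qed
  also have "\<dots> = S * (\<Sum>i<n. x i * y i)"
    unfolding S_def sum_product[symmetric] by (simp only: mult.commute)
  finally show ?thesis
    using A unfolding biq_def lyap_def by (simp add: S_def[symmetric] distrib_right sum.distrib)
qed

text \<open>
  Let \<open>M\<close> be the map on symmetric matrices with array \<open>d\<close>. Orthogonality at \<open>x = e\<^sub>i\<close> leaves in
  \<open>M(E\<^sub>i\<^sub>i)\<close> only the row and column \<open>i\<close>, and these determine the column \<open>i\<close> of \<open>K\<close>. After subtraction of
  the Lyapunov map all \<open>M(E\<^sub>i\<^sub>i)\<close> are zero. At \<open>x = s e\<^sub>i + t e\<^sub>j\<close> only \<open>N = M(E\<^sub>i\<^sub>j + E\<^sub>j\<^sub>i)\<close> then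
  remains, with the factor \<open>s t\<close>. A vector \<open>y\<close> with \<open>y i\<close> and \<open>y j\<close> nonzero is orthogonal to such
  an \<open>x\<close> with \<open>s t \<noteq> 0\<close>, so \<open>N\<close> vanishes on generic vectors and is zero.
\<close>

lemma biq_vanishing_on_perp:
  assumes sym1: "\<And>i j r s. i < n \<Longrightarrow> j < n \<Longrightarrow> r < n \<Longrightarrow> s < n \<Longrightarrow> d i j r s = d j i r s"
    and sym2: "\<And>i j r s. i < n \<Longrightarrow> j < n \<Longrightarrow> r < n \<Longrightarrow> s < n \<Longrightarrow> d i j r s = d i j s r"
    and van: "\<And>x y. (\<Sum>i<n. x i * y i) = 0 \<Longrightarrow> biq n d x y = 0"
  shows "\<exists>\<kappa>. \<forall>i<n. \<forall>j<n. \<forall>r<n. \<forall>s<n. 2 * d i j r s = lyap \<kappa> i j r s + lyap \<kappa> j i r s"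
proof -
  define \<kappa> where "\<kappa> i r = (if i = r then d i i i i / 2 else d i i i r)" for i r
  define e where "e i j r s = 2 * d i j r s - (lyap \<kappa> i j r s + lyap \<kappa> j i r s)" for i j r s
  have evan: "biq n e x y = 0" if "(\<Sum>i<n. x i * y i) = 0" for x y
  proof -
    have "biq n e x y = 2 * biq n d x y - (biq n (lyap \<kappa>) x y + biq n (\<lambda>i j. lyap \<kappa> j i) x y)"
      unfolding e_def biq_diff biq_add biq_cmult ..
    then show ?thesis using that van[of x y] by (simp add: biq_swap[of n "lyap \<kappa>"] biq_lyap)
  qed
  have e1: "e i j r s = e j i r s" if "i < n" "j < n" "r < n" "s < n" for i j r s
    using sym1[OF that] by (simp add: e_def)
  have e2: "e i j r s = e i j s r" if "i < n" "j < n" "r < n" "s < n" for i j r s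
    using sym2[OF that] by (simp add: e_def lyap_def)
  have diag: "e i i r s = 0" if "i < n" "r < n" "s < n" for i r s
  proof -
    have row: "e i i i u = 0" if "u < n" for u
      using that by (simp add: e_def lyap_def \<kappa>_def delta_def)
    have off: "quad n (e i i) y = 0" if "y i = 0" for y
    proof -
      have "biq n e (\<lambda>a. if a = i then 1 else 0) y = 0"
        by (rule evan) (use that in \<open>auto intro!: sum.neutral\<close>)
      then show ?thesis using \<open>i < n\<close> by (simp add: biq_eq_quad quad_one_point)
    qed
    have uu: "e i i u u = 0" if "u < n" "u \<noteq> i" for u
      using off[of "\<lambda>a. if a = u then 1 else 0"] that by (simp add: quad_one_point)
    show ?thesis
    proof (cases "r = i \<or> s = i")
      case True
      then show ?thesis using row e2 that by metis
    next
      case False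
      then show ?thesis
        using off[of "\<lambda>a. (if a = r then 1 else 0) + (if a = s then 1 else 0)"] that uu
          quad_two_point[of r n s _ 1 1] e2[of i i r s] by simp
    qed
  qed
  have "e i j r s = 0" if ij: "i < n" "j < n" and rs: "r < n" "s < n" for i j r s
  proof (cases "i = j")
    case True
    then show ?thesis using diag that by simp
  next
    case False
    have "quad n (e i j) y = 0" if y: "y i \<noteq> 0" "y j \<noteq> 0" for y
    proof -
      define x where "x a = (if a = i then y j else 0) + (if a = j then - y i else 0)" for a
      have "biq n e x y = 0"
        by (rule evan) (use ij in \<open>simp add: x_def distrib_right sum.distrib if_distrib[of "\<lambda>u. u * _"] cong: if_cong\<close>)
      moreover have "biq n e x y = - y j * y i * (quad n (e i j) y + quad n (e j i) y)"
        unfolding biq_eq_quad x_def quad_two_point[OF ij] using diag ij by (simp add: quad_def)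
      moreover have "quad n (e j i) y = quad n (e i j) y"
        unfolding quad_def using e1 ij by (intro sum.cong) auto
      ultimately show ?thesis using y by simp
    qed
    then show ?thesis using quad_generic_zero[of n "e i j" i j r s] e2 ij rs by blast
  qed
  then show ?thesis by (intro exI[of _ \<kappa>]) (simp add: e_def)
qed

section \<open>Evaluation of polynomials\<close>

definition mon_eval :: "(var \<Rightarrow> 'a::comm_ring_1) \<Rightarrow> (var \<Rightarrow>\<^sub>0 nat) \<Rightarrow> 'a" where
  "mon_eval f m = (\<Prod>v\<in>Poly_Mapping.keys m. f v ^ Poly_Mapping.lookup m v)"

lemma mon_eval_superset:
  assumes "finite V" "Poly_Mapping.keys m \<subseteq> V"
  shows "mon_eval f m = (\<Prod>v\<in>V. f v ^ Poly_Mapping.lookup m v)"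
  unfolding mon_eval_def using assms
  by (intro prod.mono_neutral_left) (auto simp: not_in_keys_iff_lookup_eq_zero)

lemma mon_eval_add: "mon_eval f (m + m') = mon_eval f m * mon_eval f m'"
proof -
  define V where "V = Poly_Mapping.keys m \<union> Poly_Mapping.keys m'"
  have "finite V" by (simp add: V_def)
  moreover have "Poly_Mapping.keys (m + m') \<subseteq> V" by (simp add: V_def keys_add)
  ultimately show ?thesis
    by (simp add: mon_eval_superset[of V] V_def lookup_add power_add prod.distrib)
qed

lemma mon_eval_zero [simp]: "mon_eval f 0 = 1"
  and mon_eval_single [simp]: "mon_eval f (Poly_Mapping.single v (Suc 0)) = f v"
  by (simp_all add: mon_eval_def)

lemma poly_eq_sum_single:
  "p = (\<Sum>m\<in>Poly_Mapping.keys p. Poly_Mapping.single m (Poly_Mapping.lookup p m))"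
proof (rule poly_mapping_eqI)
  fix k
  have "(\<Sum>m\<in>Poly_Mapping.keys p. Poly_Mapping.lookup (Poly_Mapping.single m (Poly_Mapping.lookup p m)) k)
      = (\<Sum>m\<in>Poly_Mapping.keys p. if m = k then Poly_Mapping.lookup p k else 0)"
    by (intro sum.cong) (auto simp: lookup_single)
  then show "Poly_Mapping.lookup p k = Poly_Mapping.lookup
      (\<Sum>m\<in>Poly_Mapping.keys p. Poly_Mapping.single m (Poly_Mapping.lookup p m)) k"
    by (simp add: lookup_sum not_in_keys_iff_lookup_eq_zero)
qed

text \<open>
  Evaluation is a ring homomorphism for any values of the variables once the coefficients are mapped
  by one. Both \<open>subst\<close> (coefficients become constant polynomials) and evaluation at real points are
  instances.
\<close>

locale coeff_hom =
  fixes h :: "real \<Rightarrow> 'a::comm_ring_1"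
  assumes h_add: "h (a + b) = h a + h b"
    and h_mult: "h (a * b) = h a * h b"
    and h_one: "h 1 = 1"
begin

definition ev :: "(var \<Rightarrow> 'a) \<Rightarrow> rpoly \<Rightarrow> 'a" where
  "ev f p = (\<Sum>m\<in>Poly_Mapping.keys p. h (Poly_Mapping.lookup p m) * mon_eval f m)"

lemma h_zero: "h 0 = 0"
  using h_add[of 0 0] by simp

lemma ev_superset:
  assumes "finite S" "Poly_Mapping.keys p \<subseteq> S"
  shows "ev f p = (\<Sum>m\<in>S. h (Poly_Mapping.lookup p m) * mon_eval f m)"
  unfolding ev_def using assms
  by (intro sum.mono_neutral_left) (auto simp: not_in_keys_iff_lookup_eq_zero h_zero)

lemma ev_add: "ev f (p + q) = ev f p + ev f q"
proof -
  define S where "S = Poly_Mapping.keys p \<union> Poly_Mapping.keys q"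
  have "finite S" by (simp add: S_def)
  moreover have "Poly_Mapping.keys (p + q) \<subseteq> S" by (simp add: S_def keys_add)
  ultimately show ?thesis
    by (simp add: ev_superset[of S] S_def lookup_add h_add distrib_right sum.distrib)
qed

lemma ev_zero [simp]: "ev f 0 = 0"
  by (simp add: ev_def)

lemma ev_single: "ev f (Poly_Mapping.single m c) = h c * mon_eval f m"
  by (cases "c = 0") (simp_all add: ev_def h_zero)

lemma ev_sum: "ev f (sum p I) = (\<Sum>i\<in>I. ev f (p i))"
  by (induction I rule: infinite_finite_induct) (simp_all add: ev_add)

lemma ev_mult: "ev f (p * q) = ev f p * ev f q"
proof -
  let ?c = "\<lambda>p m. Poly_Mapping.lookup p m"
  have "p * q = (\<Sum>m\<in>Poly_Mapping.keys p. Poly_Mapping.single m (?c p m)) *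
      (\<Sum>m\<in>Poly_Mapping.keys q. Poly_Mapping.single m (?c q m))"
    using poly_eq_sum_single[of p] poly_eq_sum_single[of q] by simp
  also have "\<dots> = (\<Sum>m\<in>Poly_Mapping.keys p. \<Sum>m'\<in>Poly_Mapping.keys q.
      Poly_Mapping.single (m + m') (?c p m * ?c q m'))"
    by (simp add: sum_product mult_single)
  finally show ?thesis
    by (simp add: ev_sum ev_single ev_def[of f p] ev_def[of f q] sum_product h_mult mon_eval_add mult_ac)
qed

lemma ev_Var [simp]: "ev f (Var v) = f v"
  by (simp add: Var_def ev_single h_one)

lemma ev_Const [simp]: "ev f (Const c) = h c"
  by (simp add: Const_def ev_single)

lemma ev_uminus: "ev f (- p) = - ev f p"
  using ev_add[of f p "- p"] by (simp add: eq_neg_iff_add_eq_0 add.commute)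

lemma ev_diff: "ev f (p - q) = ev f p - ev f q"
  using ev_add[of f p "- q"] by (simp add: ev_uminus)

lemma ev_power2: "ev f (p\<^sup>2) = (ev f p)\<^sup>2"
  by (simp add: power2_eq_square ev_mult)

lemmas ev_simps = ev_add ev_diff ev_uminus ev_mult ev_sum ev_power2

end

lemma Const_add: "Const (a + b) = Const a + Const b"
  and Const_mult: "Const (a * b) = Const a * Const b"
  and Const_1: "Const 1 = 1"
  by (simp_all add: Const_def single_add mult_single)

lemma Const_sum: "Const (sum c I) = (\<Sum>i\<in>I. Const (c i))"
  by (induction I rule: infinite_finite_induct) (simp_all add: Const_add, simp_all add: Const_def)

interpretation subst_hom: coeff_hom Const
  rewrites "subst_hom.ev = subst"
proof -
  show hom: "coeff_hom Const"
    by unfold_locales (simp_all add: Const_add Const_mult Const_1)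
  show "coeff_hom.ev Const = subst"
    by (simp add: fun_eq_iff coeff_hom.ev_def[OF hom] subst_def mon_eval_def)
qed

interpretation real_ev: coeff_hom "\<lambda>c::real. c"
  by unfold_locales simp_all

lemma polys_zero [simp]: "0 \<in> polys V"
  and polys_Const [simp]: "Const c \<in> polys V"
  and polys_one [simp]: "1 \<in> polys V"
  and polys_Var: "v \<in> V \<Longrightarrow> Var v \<in> polys V"
  by (simp_all add: polys_def Const_def Var_def)

lemma polys_add: "p \<in> polys V \<Longrightarrow> q \<in> polys V \<Longrightarrow> p + q \<in> polys V"
  using keys_add[of p q] by (force simp: polys_def)

lemma polys_mult:
  assumes "p \<in> polys V" "q \<in> polys V"
  shows "p * q \<in> polys V"
  unfolding polys_def
proof (intro CollectI ballI)
  fix m assume "m \<in> Poly_Mapping.keys (p * q)"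
  then obtain a b where "m = a + b" "a \<in> Poly_Mapping.keys p" "b \<in> Poly_Mapping.keys q"
    using keys_mult[of p q] by blast
  then show "Poly_Mapping.keys m \<subseteq> V"
    using assms keys_add[of a b] unfolding polys_def by blast
qed

lemma polys_uminus: "p \<in> polys V \<Longrightarrow> - p \<in> polys V"
  by (simp add: polys_def in_keys_iff)

lemma polys_diff: "p \<in> polys V \<Longrightarrow> q \<in> polys V \<Longrightarrow> p - q \<in> polys V"
  using polys_add[of p V "- q"] polys_uminus by simp

lemma polys_sum: "(\<And>i. i \<in> I \<Longrightarrow> p i \<in> polys V) \<Longrightarrow> sum p I \<in> polys V"
  by (induction I rule: infinite_finite_induct) (auto intro: polys_add)

lemma polys_power: "p \<in> polys V \<Longrightarrow> p ^ k \<in> polys V"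
  by (induction k) (auto intro: polys_mult)

lemma polys_prod: "(\<And>i. i \<in> I \<Longrightarrow> p i \<in> polys V) \<Longrightarrow> prod p I \<in> polys V"
  by (induction I rule: infinite_finite_induct) (auto intro: polys_mult)

lemmas polys_closed = polys_add polys_mult polys_uminus polys_diff polys_sum polys_power polys_prod
  polys_Const polys_zero polys_one

lemma subst_in_polys:
  assumes "p \<in> polys V" "\<And>v. v \<in> V \<Longrightarrow> f v \<in> polys W"
  shows "subst f p \<in> polys W"
  unfolding subst_def using assms(1)
  by (intro polys_closed assms(2)) (auto simp: polys_def)

lemma ring_poly_ring: "ring (poly_ring V)"
proof (rule ringI)
  show "abelian_group (poly_ring V)"
    by (rule abelian_groupI)
      (auto simp: poly_ring_def polys_closed algebra_simps intro!: bexI[of _ "- _"])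
  show "Group.monoid (poly_ring V)"
    by unfold_locales (auto simp: poly_ring_def polys_closed mult_ac)
qed (auto simp: poly_ring_def algebra_simps)

lemma multiple_in_ideal_I:
  assumes "h \<in> polys (vars_xy n)"
  shows "h * (\<Sum>i = 1..n. Var (X i) * Var (Y i)) \<in> ideal_I n"
proof -
  have "h * g \<in> J" if "ideal J (poly_ring (vars_xy n))" "g \<in> J" for J g
    using ideal.I_l_closed[OF that, of h] assms by (simp add: poly_ring_def)
  then show ?thesis by (auto simp: ideal_I_def genideal_def)
qed

text \<open>
  The polynomials killed by the substitution form an ideal that contains the generator.
\<close>

lemma subst_vanishes_on_ideal_I:
  assumes gen: "subst f (\<Sum>i = 1..n. Var (X i) * Var (Y i)) = 0"
    and p: "p \<in> ideal_I n"
  shows "subst f p = 0"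
proof -
  let ?R = "poly_ring (vars_xy n)"
  define J where "J = {p \<in> polys (vars_xy n). subst f p = 0}"
  have inv: "inv\<^bsub>add_monoid ?R\<^esub> p = - p" if "p \<in> J" for p
  proof -
    interpret ring ?R by (rule ring_poly_ring)
    have "- p \<in> polys (vars_xy n)" "p \<in> polys (vars_xy n)"
      using that by (auto simp: J_def polys_uminus)
    then show ?thesis
      using minus_equality[of "- p" p] by (simp add: poly_ring_def a_inv_def)
  qed
  have "subgroup J (add_monoid ?R)"
  proof
    show "J \<subseteq> carrier (add_monoid ?R)" by (auto simp: J_def poly_ring_def)
    show "\<And>x y. x \<in> J \<Longrightarrow> y \<in> J \<Longrightarrow> x \<otimes>\<^bsub>add_monoid ?R\<^esub> y \<in> J"
      by (auto simp: J_def poly_ring_def polys_add subst_hom.ev_simps)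
    show "\<one>\<^bsub>add_monoid ?R\<^esub> \<in> J" by (simp add: J_def poly_ring_def)
    show "inv\<^bsub>add_monoid ?R\<^esub> x \<in> J" if "x \<in> J" for x
      using that unfolding inv[OF that] by (simp add: J_def polys_uminus subst_hom.ev_simps)
  qed
  then have "ideal J ?R"
    by (rule idealI[OF ring_poly_ring])
      (auto simp: J_def poly_ring_def polys_mult subst_hom.ev_simps)
  moreover have "(\<Sum>i = 1..n. Var (X i) * Var (Y i)) \<in> J"
    using gen by (auto simp: J_def vars_xy_def intro!: polys_closed polys_Var)
  ultimately show ?thesis
    using p by (auto simp: ideal_I_def genideal_def J_def)
qed

section \<open>The polynomials of a linear map in coordinates\<close>

lemma linear_between_sum:
  assumes lin: "linear_between S T f"
    and S: "S \<subseteq> carrier_mat n n" "0\<^sub>m n n \<in> S" "\<And>U V. U \<in> S \<Longrightarrow> V \<in> S \<Longrightarrow> U + V \<in> S"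
      "\<And>c U. U \<in> S \<Longrightarrow> c \<cdot>\<^sub>m U \<in> S"
    and T: "T \<subseteq> carrier_mat n n"
    and fin: "finite K" and U: "\<And>k. k \<in> K \<Longrightarrow> U k \<in> S"
  shows "mat n n (\<lambda>(r, s). \<Sum>k\<in>K. c k * U k $$ (r, s)) \<in> S
    \<and> f (mat n n (\<lambda>(r, s). \<Sum>k\<in>K. c k * U k $$ (r, s)))
      = mat n n (\<lambda>(r, s). \<Sum>k\<in>K. c k * f (U k) $$ (r, s))"
  using fin U
proof (induction K rule: finite_induct)
  case empty
  have "f (0\<^sub>m n n) = f (0 \<cdot>\<^sub>m 0\<^sub>m n n)" by (intro arg_cong[of _ _ f] eq_matI) auto
  also have "\<dots> = 0 \<cdot>\<^sub>m f (0\<^sub>m n n)" using lin S(2) unfolding linear_between_def by blast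
  also have "\<dots> = 0\<^sub>m n n" using lin S T by (intro eq_matI) (auto simp: linear_between_def)
  finally have "f (0\<^sub>m n n) = 0\<^sub>m n n" .
  moreover have "mat n n (\<lambda>_. 0) = (0\<^sub>m n n :: real mat)" by (intro eq_matI) auto
  ultimately show ?case using S by simp
next
  case (insert k K)
  let ?W = "mat n n (\<lambda>(r, s). \<Sum>k\<in>K. c k * U k $$ (r, s))"
  have W: "?W \<in> S" "f ?W = mat n n (\<lambda>(r, s). \<Sum>k\<in>K. c k * f (U k) $$ (r, s))"
    using insert.IH[OF insert.prems[OF insertI2]] by blast+
  have k: "U k \<in> S" "c k \<cdot>\<^sub>m U k \<in> S" using insert.prems S by auto
  then have dims: "U k \<in> carrier_mat n n" "f (U k) \<in> carrier_mat n n"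
    using S T lin by (auto simp: linear_between_def)
  have eq: "mat n n (\<lambda>(r, s). \<Sum>k\<in>insert k K. c k * U k $$ (r, s)) = c k \<cdot>\<^sub>m U k + ?W"
    using insert.hyps dims by (intro eq_matI) auto
  have "f (c k \<cdot>\<^sub>m U k + ?W) = c k \<cdot>\<^sub>m f (U k) + f ?W"
    using lin k W by (simp add: linear_between_def)
  also have "\<dots> = mat n n (\<lambda>(r, s). \<Sum>k\<in>insert k K. c k * f (U k) $$ (r, s))"
    using insert.hyps dims unfolding W(2) by (intro eq_matI) auto
  finally show ?case unfolding eq using S(3)[OF k(2) W(1)] by blast
qed

definition unit_mat :: "nat \<Rightarrow> nat \<Rightarrow> nat \<Rightarrow> real mat" where
  "unit_mat n i j = mat n n (\<lambda>(r, s). delta i r * delta j s)"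

definition sym_unit_mat :: "nat \<Rightarrow> nat \<Rightarrow> nat \<Rightarrow> real mat" where
  "sym_unit_mat n i j = mat n n (\<lambda>(r, s). (delta i r * delta j s + delta j r * delta i s) / 2)"

lemma sum_delta: "j < n \<Longrightarrow> (\<Sum>i<n. delta i j * c i) = c j"
  "j < n \<Longrightarrow> (\<Sum>i<n. c i * delta i j) = c j"
  "j < n \<Longrightarrow> (\<Sum>i<n. delta j i * c i) = c j"
  "j < n \<Longrightarrow> (\<Sum>i<n. c i * delta j i) = c j"
  by (auto simp: delta_def if_distrib[of "\<lambda>u. u * _"] if_distrib[of "(*) _"] cong: if_cong)

lemma sum_delta2:
  assumes "r < n" "s < n"
  shows "(\<Sum>i<n. \<Sum>j<n. c i j * (delta i r * delta j s)) = c r s"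
proof -
  have "(\<Sum>i<n. \<Sum>j<n. c i j * (delta i r * delta j s)) = (\<Sum>i<n. delta i r * (\<Sum>j<n. c i j * delta j s))"
    by (simp add: sum_distrib_left mult_ac)
  then show ?thesis using assms by (simp add: sum_delta)
qed

lemma linear_expansion:
  assumes "linear_between (carrier_mat n n) (carrier_mat n n) B" "U \<in> carrier_mat n n" "r < n" "s < n"
  shows "B U $$ (r, s) = (\<Sum>i<n. \<Sum>j<n. U $$ (i, j) * B (unit_mat n i j) $$ (r, s))"
proof -
  have "U = mat n n (\<lambda>(r, s). \<Sum>k\<in>{..<n} \<times> {..<n}. U $$ k * unit_mat n (fst k) (snd k) $$ (r, s))"
    using assms(2) by (intro eq_matI) (auto simp: unit_mat_def sum.cartesian_product' sum_delta2)
  then have "B U = mat n n (\<lambda>(r, s). \<Sum>k\<in>{..<n} \<times> {..<n}. U $$ k * B (unit_mat n (fst k) (snd k)) $$ (r, s))"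
    using linear_between_sum[OF assms(1), of n "{..<n} \<times> {..<n}" "\<lambda>k. unit_mat n (fst k) (snd k)" "\<lambda>k. U $$ k"]
    by (auto simp: unit_mat_def)
  then show ?thesis using assms by (simp add: sum.cartesian_product')
qed

lemma sym_linear_expansion:
  assumes "linear_between (sym_mats n) (sym_mats n) A" "U \<in> sym_mats n" "r < n" "s < n"
  shows "A U $$ (r, s) = (\<Sum>i<n. \<Sum>j<n. U $$ (i, j) * A (sym_unit_mat n i j) $$ (r, s))"
proof -
  have U: "U \<in> carrier_mat n n" and tr: "transpose_mat U = U"
    using assms(2) by (simp_all add: sym_mats_def)
  have sym: "U $$ (j, i) = U $$ (i, j)" if "i < n" "j < n" for i j
    using arg_cong[OF tr, of "\<lambda>M. M $$ (i, j)"] that U by simp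
  have "(\<Sum>i<n. \<Sum>j<n. U $$ (i, j) * sym_unit_mat n i j $$ (r, s)) = U $$ (r, s)" if "r < n" "s < n" for r s
  proof -
    have "(\<Sum>i<n. \<Sum>j<n. U $$ (i, j) * sym_unit_mat n i j $$ (r, s))
        = (\<Sum>i<n. \<Sum>j<n. U $$ (i, j) * (delta i r * delta j s)) / 2
        + (\<Sum>i<n. \<Sum>j<n. U $$ (i, j) * (delta i s * delta j r)) / 2"
      unfolding sum_divide_distrib sum.distrib[symmetric] using that
      by (intro sum.cong refl) (simp add: sym_unit_mat_def field_simps)
    then show ?thesis using that by (simp add: sum_delta2 sym)
  qed
  then have "U = mat n n (\<lambda>(r, s). \<Sum>k\<in>{..<n} \<times> {..<n}. U $$ k * sym_unit_mat n (fst k) (snd k) $$ (r, s))"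
    using U by (intro eq_matI) (auto simp: sum.cartesian_product')
  moreover have "sym_unit_mat n i j \<in> sym_mats n" for i j
    by (auto simp: sym_unit_mat_def sym_mats_def intro!: eq_matI)
  moreover have "U + V \<in> sym_mats n" if "U \<in> sym_mats n" "V \<in> sym_mats n" for U V
    using that by (auto simp: sym_mats_def transpose_add)
  moreover have "c \<cdot>\<^sub>m U \<in> sym_mats n" if "U \<in> sym_mats n" for U c
  proof -
    have "transpose_mat (c \<cdot>\<^sub>m U) = c \<cdot>\<^sub>m transpose_mat U" by (intro eq_matI) auto
    then show ?thesis using that by (simp add: sym_mats_def)
  qed
  moreover have "sym_mats n \<subseteq> carrier_mat n n" "0\<^sub>m n n \<in> sym_mats n" by (auto simp: sym_mats_def)
  ultimately have "A U = mat n n (\<lambda>(r, s). \<Sum>k\<in>{..<n} \<times> {..<n}. U $$ k * A (sym_unit_mat n (fst k) (snd k)) $$ (r, s))"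
    using linear_between_sum[OF assms(1), of n "{..<n} \<times> {..<n}" "\<lambda>k. sym_unit_mat n (fst k) (snd k)" "\<lambda>k. U $$ k"]
    by auto
  then show ?thesis using assms by (simp add: sum.cartesian_product')
qed

text \<open>
  The coordinates of \<open>A\<close> in the spanning set \<open>(E\<^sub>i\<^sub>j + E\<^sub>j\<^sub>i)/2\<close> of the symmetric matrices; a symmetric
  \<open>U\<close> has the coefficient \<open>U\<^sub>i\<^sub>j\<close> at the pair \<open>(i, j)\<close>, with no case distinction for \<open>i = j\<close>.
\<close>

definition tensor :: "nat \<Rightarrow> (real mat \<Rightarrow> real mat) \<Rightarrow> nat \<Rightarrow> nat \<Rightarrow> nat \<Rightarrow> nat \<Rightarrow> real" where
  "tensor n A i j r s = A (sym_unit_mat n i j) $$ (r, s)"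

text \<open>
  The coefficient matrix of \<open>xx\<^sup>T\<close> at a monomial \<open>m\<close> has the entry 1 exactly where \<open>x\<^sub>i x\<^sub>j = m\<close>.
  Expanding \<open>A\<close> in coordinates and exchanging sums leaves one monomial for each pair \<open>(i, j)\<close>.
\<close>

lemma poly_ext_xxT:
  assumes lin: "linear_between (sym_mats n) (sym_mats n) A" and rs: "r < n" "s < n"
  shows "poly_ext n A (xxT n) $$ (r, s)
    = (\<Sum>i<n. \<Sum>j<n. Const (tensor n A i j r s) * Var (X (i + 1)) * Var (X (j + 1)))"
proof -
  define xm where "xm i j = Poly_Mapping.single (X (i + 1)) (1::nat) + Poly_Mapping.single (X (j + 1)) 1" for i j
  define S where "S = (\<Union>r<n. \<Union>c<n. Poly_Mapping.keys (xxT n $$ (r, c)))"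
  have entry: "xxT n $$ (i, j) = Poly_Mapping.single (xm i j) 1" if "i < n" "j < n" for i j
    using that by (simp add: xxT_def x_vec_def Var_def mult_single xm_def)
  have S: "xm i j \<in> S" if "i < n" "j < n" for i j
    using that by (force simp: S_def entry)
  have "finite S" by (simp add: S_def)
  have cm: "coeff_mat n (xxT n) m $$ (i, j) = (if m = xm i j then 1 else 0)" if "i < n" "j < n" for m i j
    using that by (auto simp: coeff_mat_def entry lookup_single)
  have comm: "xm i j = xm j i" for i j by (simp add: xm_def add.commute)
  have "coeff_mat n (xxT n) m \<in> sym_mats n" for m
    by (auto simp: sym_mats_def coeff_mat_def entry lookup_single comm intro!: eq_matI)
  then have A: "A (coeff_mat n (xxT n) m) $$ (r, s)
      = (\<Sum>i<n. \<Sum>j<n. if m = xm i j then tensor n A i j r s else 0)" for m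
    unfolding tensor_def by (subst sym_linear_expansion[OF lin _ rs]) (auto simp: cm intro!: sum.cong)
  have single_sum: "Poly_Mapping.single m (sum g I) = (\<Sum>i\<in>I. Poly_Mapping.single m (g i))"
    for m :: "var \<Rightarrow>\<^sub>0 nat" and g :: "nat \<Rightarrow> real" and I
    by (induction I rule: infinite_finite_induct) (simp_all add: single_add)
  have "poly_ext n A (xxT n) $$ (r, s)
      = (\<Sum>m\<in>S. \<Sum>i<n. \<Sum>j<n. Poly_Mapping.single m (if m = xm i j then tensor n A i j r s else 0))"
    using rs by (simp add: poly_ext_def S_def[symmetric] A single_sum)
  also have "\<dots> = (\<Sum>i<n. \<Sum>m\<in>S. \<Sum>j<n. Poly_Mapping.single m (if m = xm i j then tensor n A i j r s else 0))"
    by (rule sum.swap)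
  also have "\<dots> = (\<Sum>i<n. \<Sum>j<n. \<Sum>m\<in>S. Poly_Mapping.single m (if m = xm i j then tensor n A i j r s else 0))"
    by (intro sum.cong refl sum.swap)
  also have "\<dots> = (\<Sum>i<n. \<Sum>j<n. Poly_Mapping.single (xm i j) (tensor n A i j r s))"
  proof (intro sum.cong refl)
    fix i j assume ij: "i \<in> {..<n}" "j \<in> {..<n}"
    have "(\<Sum>m\<in>S. Poly_Mapping.single m (if m = xm i j then tensor n A i j r s else 0))
        = (\<Sum>m\<in>S. if m = xm i j then Poly_Mapping.single (xm i j) (tensor n A i j r s) else 0)"
      by (intro sum.cong) auto
    then show "(\<Sum>m\<in>S. Poly_Mapping.single m (if m = xm i j then tensor n A i j r s else 0))
        = Poly_Mapping.single (xm i j) (tensor n A i j r s)"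
      using ij S \<open>finite S\<close> by simp
  qed
  also have "\<dots> = (\<Sum>i<n. \<Sum>j<n. Const (tensor n A i j r s) * Var (X (i + 1)) * Var (X (j + 1)))"
    by (simp add: Const_def Var_def mult_single xm_def)
  finally show ?thesis .
qed

lemma sum_swap_pairs:
  "(\<Sum>r\<in>S. \<Sum>s\<in>S. \<Sum>i\<in>S. \<Sum>j\<in>S. g i j r s) = (\<Sum>i\<in>S. \<Sum>j\<in>S. \<Sum>r\<in>S. \<Sum>s\<in>S. g i j r s)"
proof -
  have "(\<Sum>r\<in>S. \<Sum>s\<in>S. \<Sum>i\<in>S. \<Sum>j\<in>S. g i j r s)
      = (\<Sum>p\<in>S \<times> S. \<Sum>q\<in>S \<times> S. g (fst q) (snd q) (fst p) (snd p))"
    by (simp add: sum.cartesian_product')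
  also have "\<dots> = (\<Sum>q\<in>S \<times> S. \<Sum>p\<in>S \<times> S. g (fst q) (snd q) (fst p) (snd p))"
    by (rule sum.swap)
  finally show ?thesis by (simp add: sum.cartesian_product')
qed

lemma p_poly_eq:
  assumes "linear_between (sym_mats n) (sym_mats n) A"
  shows "p_poly n A = (\<Sum>i<n. \<Sum>j<n. \<Sum>r<n. \<Sum>s<n. Const (tensor n A i j r s) *
    Var (X (i + 1)) * Var (X (j + 1)) * Var (Y (r + 1)) * Var (Y (s + 1)))"
proof -
  have "p_poly n A = (\<Sum>r<n. Var (Y (r + 1)) * (\<Sum>s<n. poly_ext n A (xxT n) $$ (r, s) * Var (Y (s + 1))))"
    by (simp add: p_poly_def y_vec_def scalar_prod_def poly_ext_def atLeast0LessThan)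
  also have "\<dots> = (\<Sum>r<n. \<Sum>s<n. \<Sum>i<n. \<Sum>j<n. Const (tensor n A i j r s) *
    Var (X (i + 1)) * Var (X (j + 1)) * Var (Y (r + 1)) * Var (Y (s + 1)))"
    by (simp add: poly_ext_xxT[OF assms] sum_distrib_left sum_distrib_right mult_ac)
  also have "\<dots> = (\<Sum>i<n. \<Sum>j<n. \<Sum>r<n. \<Sum>s<n. Const (tensor n A i j r s) *
    Var (X (i + 1)) * Var (X (j + 1)) * Var (Y (r + 1)) * Var (Y (s + 1)))"
    by (rule sum_swap_pairs)
  finally show ?thesis .
qed

text \<open>
  A point of \<open>(x,\<alpha>)\<close>-space, as an assignment of values to all variables; the \<open>Y i\<close> do not occur in
  \<open>\<real>[x,\<alpha>]\<close>.
\<close>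

definition point :: "(nat \<Rightarrow> real) \<Rightarrow> (nat \<Rightarrow> real) \<Rightarrow> var \<Rightarrow> real" where
  "point x \<alpha> v = (case v of X i \<Rightarrow> x (i - 1) | Alpha k \<Rightarrow> \<alpha> (k - 1) | Y i \<Rightarrow> 0)"

lemma point_simps [simp]: "point x \<alpha> (X (Suc i)) = x i" "point x \<alpha> (Alpha (Suc k)) = \<alpha> k"
  by (simp_all add: point_def)

lemma eval_psi_y:
  assumes "n \<ge> 2" "r < n"
  shows "real_ev.ev (point x \<alpha>) (psi_y n (r + 1)) = perp_vec n x \<alpha> r"
proof -
  consider "r = 0" | q where "r = Suc q" "r + 1 = n" | q where "r = Suc q" "r + 1 < n"
    using assms by (cases r) force+
  then show ?thesis
    using assms by cases (auto simp: psi_y_def perp_vec_def real_ev.ev_simps point_def numeral_2_eq_2)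
qed

lemma eval_q_poly:
  assumes "n \<ge> 2" "linear_between (sym_mats n) (sym_mats n) A"
  shows "real_ev.ev (point x \<alpha>) (q_poly n A) = biq n (tensor n A) x (perp_vec n x \<alpha>)"
  unfolding q_poly_def p_poly_eq[OF assms(2)] biq_def
  using eval_psi_y[OF assms(1)] by (simp add: subst_hom.ev_simps real_ev.ev_simps)

text \<open>
  The sum telescopes: the product of \<open>x\<^sub>i\<close> with the \<open>i\<close>-th coordinate is \<open>T\<^sub>i - T\<^sub>i\<^sub>-\<^sub>1\<close> for
  \<open>T\<^sub>i = \<alpha>\<^sub>i x\<^sub>i x\<^sub>i\<^sub>+\<^sub>1\<close>, and the boundary terms \<open>T\<^sub>0\<close> and \<open>T\<^sub>n\<close> are zero.
\<close>

lemma subst_Psi_generator: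
  assumes "n \<ge> 2"
  shows "subst (Psi n) (\<Sum>i = 1..n. Var (X i) * Var (Y i)) = 0"
proof -
  define T where "T i = (if 1 \<le> i \<and> i < n then Var (Alpha i) * Var (X i) * Var (X (i + 1)) else 0)" for i
  have "subst (Psi n) (\<Sum>i = 1..n. Var (X i) * Var (Y i)) = (\<Sum>i = 1..n. Var (X i) * psi_y n i)"
    by (simp add: subst_hom.ev_simps)
  also have "\<dots> = (\<Sum>i = 1..n. T i - T (i - 1))"
  proof (intro sum.cong refl)
    fix i assume i: "i \<in> {1..n}"
    consider "i = 1" | q where "i = Suc q" "q > 0" "i = n" | q where "i = Suc q" "q > 0" "i < n"
      using assms i by (cases i) force+
    then show "Var (X i) * psi_y n i = T i - T (i - 1)"
      using assms by cases (auto simp: psi_y_def T_def algebra_simps numeral_2_eq_2)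
  qed
  also have "\<dots> = T n - T 0"
    by (induction n) (simp_all)
  finally show ?thesis by (simp add: T_def)
qed

section \<open>Square roots of bihomogeneous forms\<close>

text \<open>
  For \<open>D = 0\<close> a bounded polynomial is constant. In the induction step the bound at \<open>t = 0\<close> gives a root
  there, and dividing by \<open>t\<close> lowers the exponent; continuity restores the bound at \<open>t = 0\<close>.
\<close>

lemma poly_power_bound:
  fixes P :: "real poly"
  assumes "\<And>t. (poly P t)\<^sup>2 \<le> b * t ^ (2 * D)"
  shows "\<exists>c. P = monom c D"
  using assms
proof (induction D arbitrary: P)
  case 0
  have "degree P = 0"
  proof (rule ccontr)
    assume "degree P \<noteq> 0"
    then have "P \<noteq> 0" by auto
    then have deg: "degree (P * P) > 0" using \<open>degree P \<noteq> 0\<close> by (simp add: degree_mult_eq)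
    \<comment> \<open>If \<open>P\<close> were not constant, \<open>P\<^sup>2 - b\<close> would have a positive leading coefficient and
      hence positive values.\<close>
    define G where "G = P * P - [:b:]"
    have "degree G = degree (P * P)"
      using deg unfolding G_def by (metis degree_add_eq_left degree_minus degree_pCons_0 diff_conv_add_uminus)
    moreover have "coeff G (degree (P * P)) = lead_coeff (P * P)"
      using deg by (simp add: G_def coeff_eq_0)
    moreover have "lead_coeff (P * P) > 0" using \<open>P \<noteq> 0\<close>
      by (metis lead_coeff_mult leading_coeff_0_iff not_real_square_gt_zero)
    ultimately have pos: "lead_coeff G > 0" by simp
    obtain t where t: "lead_coeff G \<le> poly G t" using poly_pinfty_gt_lc[OF pos] by blast
    then show False using 0[of t] pos by (simp add: G_def power2_eq_square)
  qed
  then show ?case by (metis degree_0_id monom_0)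
next
  case (Suc D)
  have "poly P 0 = 0" using Suc.prems[of 0] by simp
  then obtain R where R: "P = pCons 0 R" by (metis pCons_cases poly_pCons mult_zero_left add.right_neutral)
  have nz: "(poly R t)\<^sup>2 \<le> b * t ^ (2 * D)" if "t \<noteq> 0" for t
  proof -
    have "t\<^sup>2 * (poly R t)\<^sup>2 \<le> t\<^sup>2 * (b * t ^ (2 * D))"
      using Suc.prems[of t] by (simp add: R power_mult_distrib power_add[symmetric] algebra_simps power2_eq_square)
    then show ?thesis using that by simp
  qed
  have "((\<lambda>t. (poly R t)\<^sup>2) \<longlongrightarrow> (poly R 0)\<^sup>2) (at 0)"
    by (intro tendsto_intros)
  moreover have "((\<lambda>t. b * t ^ (2 * D)) \<longlongrightarrow> b * 0 ^ (2 * D)) (at 0)"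
    by (intro tendsto_intros)
  ultimately have "(poly R 0)\<^sup>2 \<le> b * 0 ^ (2 * D)"
    using nz by (intro tendsto_le[of "at (0::real)"]) (auto simp: eventually_at_filter)
  with nz have "(poly R t)\<^sup>2 \<le> b * t ^ (2 * D)" for t by (cases "t = 0") auto
  from Suc.IH[OF this] obtain c where "R = monom c D" by blast
  then show ?case by (intro exI[of _ c]) (simp add: R monom_Suc)
qed

text \<open>
  The bound turns the sum into a single power of \<open>t\<close>, so at \<open>t = 1\<close> only the terms of degree \<open>D\<close> count.
\<close>

lemma graded_sum_eq_part:
  fixes c :: "'a \<Rightarrow> real" and d :: "'a \<Rightarrow> nat"
  assumes fin: "finite S"
    and bound: "\<And>t. (\<Sum>m\<in>S. c m * t ^ d m)\<^sup>2 \<le> b * t ^ (2 * D)"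
  shows "(\<Sum>m\<in>S. c m) = (\<Sum>m | m \<in> S \<and> d m = D. c m)"
proof -
  define P where "P = (\<Sum>m\<in>S. monom (c m) (d m))"
  have poly: "poly P t = (\<Sum>m\<in>S. c m * t ^ d m)" for t
    by (simp add: P_def poly_sum poly_monom)
  obtain a where a: "P = monom a D" using poly_power_bound[of P b D] bound poly by auto
  have "coeff P D = (\<Sum>m\<in>S. if d m = D then c m else 0)"
    by (simp add: P_def coeff_sum)
  also have "\<dots> = (\<Sum>m | m \<in> S \<and> d m = D. c m)"
    using fin by (simp add: sum.If_cases Int_def)
  finally have "(\<Sum>m | m \<in> S \<and> d m = D. c m) = a" by (simp add: a)
  moreover have "poly P 1 = a" by (simp add: a poly_monom)
  ultimately show ?thesis using poly[of 1] by simp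
qed

definition wdeg :: "(var \<Rightarrow> nat) \<Rightarrow> (var \<Rightarrow>\<^sub>0 nat) \<Rightarrow> nat" where
  "wdeg w m = (\<Sum>v\<in>Poly_Mapping.keys m. w v * Poly_Mapping.lookup m v)"

fun x_weight :: "var \<Rightarrow> nat" where
  "x_weight (X i) = 1" | "x_weight _ = 0"

fun alpha_weight :: "var \<Rightarrow> nat" where
  "alpha_weight (Alpha k) = 1" | "alpha_weight _ = 0"

lemma mon_eval_weighted: "mon_eval (\<lambda>v. t ^ w v * f v) m = t ^ wdeg w m * mon_eval f m"
  by (simp add: mon_eval_def wdeg_def power_mult_distrib prod.distrib power_sum power_mult)

lemma wdeg_superset:
  assumes "finite V" "Poly_Mapping.keys m \<subseteq> V"
  shows "wdeg w m = (\<Sum>v\<in>V. w v * Poly_Mapping.lookup m v)"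
  unfolding wdeg_def using assms
  by (intro sum.mono_neutral_left) (auto simp: not_in_keys_iff_lookup_eq_zero)

lemma wdeg_add: "wdeg w (m + m') = wdeg w m + wdeg w m'"
proof -
  define V where "V = Poly_Mapping.keys m \<union> Poly_Mapping.keys m'"
  have "finite V" by (simp add: V_def)
  moreover have "Poly_Mapping.keys (m + m') \<subseteq> V" by (simp add: V_def keys_add)
  ultimately show ?thesis
    by (simp add: wdeg_superset[of V] V_def lookup_add distrib_left sum.distrib)
qed

lemma wdeg_single: "wdeg w (Poly_Mapping.single v 1) = w v"
  by (simp add: wdeg_def)

lemma split_off_variable:
  assumes "wdeg w m \<noteq> 0"
  obtains v m' where "v \<in> Poly_Mapping.keys m" "w v \<noteq> 0"
    "m = Poly_Mapping.single v 1 + m'" "Poly_Mapping.keys m' \<subseteq> Poly_Mapping.keys m"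
proof -
  obtain v where v: "v \<in> Poly_Mapping.keys m" "w v \<noteq> 0"
  proof (rule ccontr)
    assume "\<not> thesis"
    then have "wdeg w m = 0" using that unfolding wdeg_def by (intro sum.neutral) auto
    with assms show False ..
  qed
  have "m = Poly_Mapping.single v 1 + (m - Poly_Mapping.single v 1)"
    using v by (intro poly_mapping_eqI) (auto simp: lookup_add lookup_minus lookup_single in_keys_iff when_def)
  moreover have "Poly_Mapping.keys (m - Poly_Mapping.single v 1) \<subseteq> Poly_Mapping.keys m"
    by (auto simp: in_keys_iff lookup_minus)
  ultimately show ?thesis using that v by blast
qed

text \<open>
  Split off one \<open>\<alpha>\<close> and two \<open>x\<close> variables; what is left has weight zero for both gradings and is 1.
\<close>

lemma bidegree_1_2_monomial:
  assumes keys: "Poly_Mapping.keys m \<subseteq> vars_xa n" and deg: "wdeg alpha_weight m = 1" "wdeg x_weight m = 2"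
  shows "\<exists>k<n-1. \<exists>i<n. \<exists>j<n. \<forall>x \<alpha>. mon_eval (point x \<alpha>) m = \<alpha> k * x i * x j"
proof -
  obtain u m1 where u: "u \<in> Poly_Mapping.keys m" "alpha_weight u \<noteq> 0" and m1: "m = Poly_Mapping.single u 1 + m1"
    "Poly_Mapping.keys m1 \<subseteq> Poly_Mapping.keys m"
    using split_off_variable[of alpha_weight m] deg by auto
  obtain k where k: "u = Alpha (Suc k)" "k < n - 1"
    using u keys by (cases u) (force simp: vars_xa_def image_iff Suc_le_eq gr0_conv_Suc)+
  have deg1: "wdeg alpha_weight m1 = 0" "wdeg x_weight m1 = 2"
    using deg unfolding m1(1) wdeg_add wdeg_single by (simp_all add: k)
  obtain v m2 where v: "v \<in> Poly_Mapping.keys m1" "x_weight v \<noteq> 0" and m2: "m1 = Poly_Mapping.single v 1 + m2"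
    "Poly_Mapping.keys m2 \<subseteq> Poly_Mapping.keys m1"
    using split_off_variable[of x_weight m1] deg1 by auto
  have "v \<in> vars_xa n" using v m1 keys by blast
  then obtain i where i: "v = X (Suc i)" "i < n"
    using v by (cases v) (force simp: vars_xa_def image_iff Suc_le_eq gr0_conv_Suc)+
  have deg2: "wdeg alpha_weight m2 = 0" "wdeg x_weight m2 = 1"
    using deg1 unfolding m2(1) wdeg_add wdeg_single by (simp_all add: i)
  obtain w m3 where w: "w \<in> Poly_Mapping.keys m2" "x_weight w \<noteq> 0" and m3: "m2 = Poly_Mapping.single w 1 + m3"
    "Poly_Mapping.keys m3 \<subseteq> Poly_Mapping.keys m2"
    using split_off_variable[of x_weight m2] deg2 by auto
  have "w \<in> vars_xa n" using w m1 m2 keys by blast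
  then obtain j where j: "w = X (Suc j)" "j < n"
    using w by (cases w) (force simp: vars_xa_def image_iff Suc_le_eq gr0_conv_Suc)+
  have deg3: "wdeg alpha_weight m3 = 0" "wdeg x_weight m3 = 0"
    using deg2 unfolding m3(1) wdeg_add wdeg_single by (simp_all add: j)
  have "Poly_Mapping.keys m3 = {}"
  proof (rule ccontr)
    assume "Poly_Mapping.keys m3 \<noteq> {}"
    then obtain z where z: "z \<in> Poly_Mapping.keys m3" by blast
    then have "z \<in> vars_xa n" using m1 m2 m3 keys by blast
    moreover have "alpha_weight z = 0" "x_weight z = 0"
      using deg3 z by (auto simp: wdeg_def in_keys_iff)
    ultimately show False by (auto simp: vars_xa_def)
  qed
  then have "m3 = 0" by simp
  then have "mon_eval (point x \<alpha>) m = \<alpha> k * x i * x j" for x \<alpha>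
    by (simp add: m1(1) m2(1) m3(1) mon_eval_add k i j)
  then show ?thesis using k i j by blast
qed

text \<open>
  Scaling \<open>\<alpha>\<close> by \<open>t\<close> multiplies the bound by \<open>t\<^sup>2\<close>, and scaling \<open>x\<close> by \<open>t\<close> multiplies it by \<open>t\<^sup>4\<close>.
  The square root thus has only terms of degree 1 in \<open>\<alpha>\<close> and 2 in \<open>x\<close>. As functions of
  \<open>x\<close> and \<open>\<alpha>\<close>, the other terms cancel, first those of wrong degree in \<open>\<alpha>\<close> and then in \<open>x\<close>.
\<close>

lemma bihomogeneous_of_square_bound:
  assumes q: "q \<in> polys (vars_xa n)"
    and bound: "\<And>x \<alpha>. (real_ev.ev (point x \<alpha>) q)\<^sup>2 \<le> biq n d x (perp_vec n x \<alpha>)"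
  shows "\<exists>F. \<forall>x \<alpha>. real_ev.ev (point x \<alpha>) q = (\<Sum>k<n-1. \<alpha> k * quad n (F k) x)"
proof -
  define c where "c = Poly_Mapping.lookup q"
  define S1 where "S1 = {m \<in> Poly_Mapping.keys q. wdeg alpha_weight m = 1}"
  define S2 where "S2 = {m \<in> S1. wdeg x_weight m = 2}"
  have fin: "finite S1" "finite S2" by (auto simp: S1_def S2_def)
  have scale_alpha: "point x (\<lambda>k. t * \<alpha> k) = (\<lambda>v. t ^ alpha_weight v * point x \<alpha> v)"
    and scale_x: "point (\<lambda>k. t * x k) \<alpha> = (\<lambda>v. t ^ x_weight v * point x \<alpha> v)" for x \<alpha> t
    by (auto simp: fun_eq_iff point_def split: var.splits)
  have perp_scale: "perp_vec n x (\<lambda>k. t * \<alpha> k) = (\<lambda>r. t * perp_vec n x \<alpha> r)"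
    "perp_vec n (\<lambda>i. t * x i) \<alpha> = (\<lambda>r. t * perp_vec n x \<alpha> r)" for x \<alpha> t
    by (auto simp: fun_eq_iff perp_vec_def algebra_simps)
  have 1: "real_ev.ev (point x \<alpha>) q = (\<Sum>m\<in>S1. c m * mon_eval (point x \<alpha>) m)" for x \<alpha>
  proof -
    have "(\<Sum>m\<in>Poly_Mapping.keys q. c m * mon_eval (point x \<alpha>) m * t ^ wdeg alpha_weight m)\<^sup>2
        \<le> biq n d x (perp_vec n x \<alpha>) * t ^ (2 * 1)" for t
      using bound[of x "\<lambda>k. t * \<alpha> k"] 
      unfolding scale_alpha perp_scale biq_scale real_ev.ev_def mon_eval_weighted c_def
      by (simp add: mult_ac)
    from graded_sum_eq_part[OF _ this] show ?thesis
      by (simp add: real_ev.ev_def c_def S1_def)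
  qed
  have 2: "real_ev.ev (point x \<alpha>) q = (\<Sum>m\<in>S2. c m * mon_eval (point x \<alpha>) m)" for x \<alpha>
  proof -
    have "(\<Sum>m\<in>S1. c m * mon_eval (point x \<alpha>) m * t ^ wdeg x_weight m)\<^sup>2
        \<le> biq n d x (perp_vec n x \<alpha>) * t ^ (2 * 2)" for t
      using bound[of "\<lambda>k. t * x k" \<alpha>] 
      unfolding 1
      unfolding perp_scale biq_scale biq_scale_left scale_x mon_eval_weighted
      by (simp add: mult_ac power2_eq_square power4_eq_xxxx)
    from graded_sum_eq_part[OF fin(1) this] show ?thesis
      by (simp add: 1 S2_def)
  qed
  have "\<exists>F. \<forall>x \<alpha>. (\<Sum>m\<in>T. c m * mon_eval (point x \<alpha>) m) = (\<Sum>k<n-1. \<alpha> k * quad n (F k) x)"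
    if "T \<subseteq> S2" for T
    using finite_subset[OF that fin(2)] that
  proof (induction T rule: finite_induct)
    case empty
    show ?case by (rule exI[of _ "\<lambda>_ _ _. 0"]) (simp add: quad_def)
  next
    case (insert m T)
    then obtain F where F: "\<And>x \<alpha>. (\<Sum>m\<in>T. c m * mon_eval (point x \<alpha>) m) = (\<Sum>k<n-1. \<alpha> k * quad n (F k) x)"
      by auto
    have "Poly_Mapping.keys m \<subseteq> vars_xa n" "wdeg alpha_weight m = 1" "wdeg x_weight m = 2"
      using insert.prems q by (auto simp: S1_def S2_def polys_def)
    from bidegree_1_2_monomial[OF this] obtain k i j where kij: "k < n - 1" "i < n" "j < n"
      and m: "\<And>x \<alpha>. mon_eval (point x \<alpha>) m = \<alpha> k * x i * x j" by blast
    define G where "G k' i' j' = F k' i' j' + c m * delta k' k * (delta i' i * delta j' j)" for k' i' j'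
    have quad: "quad n (G k') x = quad n (F k') x + c m * x i * x j * delta k' k" for k' x
    proof -
      have "quad n (G k') x = quad n (F k') x
          + (\<Sum>a<n. \<Sum>b<n. c m * delta k' k * x a * x b * (delta a i * delta b j))"
        unfolding quad_def G_def distrib_right sum.distrib by (simp add: mult_ac)
      then show ?thesis using sum_delta2[OF kij(2,3), of "\<lambda>a b. c m * delta k' k * x a * x b"]
        by (simp add: mult_ac)
    qed
    have "(\<Sum>m\<in>insert m T. c m * mon_eval (point x \<alpha>) m) = (\<Sum>k<n-1. \<alpha> k * quad n (G k) x)" for x \<alpha>
    proof -
      have "(\<Sum>k<n-1. \<alpha> k * quad n (G k) x)
          = (\<Sum>k<n-1. \<alpha> k * quad n (F k) x) + (\<Sum>k'<n-1. \<alpha> k' * (c m * x i * x j) * delta k' k)"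
        by (simp add: quad distrib_left sum.distrib mult_ac)
      then show ?thesis using insert.hyps kij by (simp add: F m sum_delta)
    qed
    then show ?case by blast
  qed
  then show ?thesis unfolding 2 by blast
qed

section \<open>Completely cross-positive maps\<close>

definition choi_map :: "nat \<Rightarrow> (nat \<Rightarrow> nat \<Rightarrow> nat \<Rightarrow> nat \<Rightarrow> real) \<Rightarrow> real mat \<Rightarrow> real mat" where
  "choi_map n \<beta> U = mat n n (\<lambda>(r, s). \<Sum>i<n. \<Sum>j<n. U $$ (i, j) * \<beta> i j r s)"

lemma block_index_less:
  assumes "a < k" "i < n"
  shows "a * n + i < k * (n::nat)"
proof -
  have "a * n + i < Suc a * n" using assms by simp
  also have "\<dots> \<le> k * n" using assms by (intro mult_right_mono) auto
  finally show ?thesis .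
qed

lemma sum_blocks: "(\<Sum>p<k * n. g p) = (\<Sum>a<k. \<Sum>i<n. g (a * n + i))" for g :: "nat \<Rightarrow> real"
proof -
  have "(\<Sum>p<k * n. g p) = (\<Sum>a<k. sum g {a * n..<a * n + n})"
    by (rule sum.nat_group[symmetric])
  also have "\<dots> = (\<Sum>a<k. \<Sum>i<n. g (a * n + i))"
  proof (rule sum.cong[OF refl])
    fix a
    show "sum g {a * n..<a * n + n} = (\<Sum>i<n. g (a * n + i))"
      using sum.shift_bounds_nat_ivl[of g 0 "a * n" n] by (simp add: add.commute lessThan_atLeast0)
  qed
  finally show ?thesis .
qed

lemma mat_inner_eq:
  assumes "C \<in> carrier_mat m m" "D \<in> carrier_mat m m"
  shows "mat_inner C D = (\<Sum>p<m. \<Sum>q<m. C $$ (p, q) * D $$ (p, q))"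
proof -
  have "mat_inner C D = (\<Sum>q<m. \<Sum>p<m. D $$ (p, q) * C $$ (p, q))"
    using assms by (simp add: mat_inner_def mat_trace_def scalar_prod_def atLeast0LessThan)
  then show ?thesis by (subst sum.swap) (simp add: mult.commute)
qed

lemma mat_inner_ampliation:
  assumes "V \<in> carrier_mat (k * n) (k * n)"
  shows "mat_inner (ampliation k n B U) V = (\<Sum>a<k. \<Sum>b<k. \<Sum>r<n. \<Sum>s<n.
    B (mat_block n U a b) $$ (r, s) * V $$ (a * n + r, b * n + s))"
proof -
  have "mat_inner (ampliation k n B U) V
      = (\<Sum>p<k * n. \<Sum>q<k * n. ampliation k n B U $$ (p, q) * V $$ (p, q))"
    using assms by (intro mat_inner_eq) (simp_all add: ampliation_def)
  also have "\<dots> = (\<Sum>a<k. \<Sum>r<n. \<Sum>b<k. \<Sum>s<n.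
      ampliation k n B U $$ (a * n + r, b * n + s) * V $$ (a * n + r, b * n + s))"
    by (simp only: sum_blocks)
  also have "\<dots> = (\<Sum>a<k. \<Sum>r<n. \<Sum>b<k. \<Sum>s<n.
      B (mat_block n U a b) $$ (r, s) * V $$ (a * n + r, b * n + s))"
    by (intro sum.cong refl) (auto simp: ampliation_def block_index_less)
  also have "\<dots> = (\<Sum>a<k. \<Sum>b<k. \<Sum>r<n. \<Sum>s<n.
      B (mat_block n U a b) $$ (r, s) * V $$ (a * n + r, b * n + s))"
    by (intro sum.cong refl sum.swap)
  finally show ?thesis .
qed

lemma psd_mats_gram:
  assumes "U \<in> psd_mats m"
  shows "\<exists>(N::nat) u. \<forall>p<m. \<forall>q<m. U $$ (p, q) = (\<Sum>l<N. u l p * u l q)"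
proof -
  have U: "U \<in> carrier_mat m m" and tr: "transpose_mat U = U"
    and pos: "\<And>v. v \<in> carrier_vec m \<Longrightarrow> 0 \<le> v \<bullet> (U *\<^sub>v v)"
    using assms by (auto simp: psd_mats_def sym_mats_def)
  have sym: "U $$ (p, q) = U $$ (q, p)" if "p \<in> {..<m}" "q \<in> {..<m}" for p q
    using arg_cong[OF tr, of "\<lambda>M. M $$ (p, q)"] that U by simp
  have "0 \<le> (\<Sum>i\<in>{..<m}. \<Sum>j\<in>{..<m}. U $$ (i, j) * z i * z j)" for z
    using pos[of "vec m z"] U by (simp add: scalar_prod_def atLeast0LessThan sum_distrib_left mult_ac)
  from psd_gram[of "{..<m}" "\<lambda>p q. U $$ (p, q)", OF _ sym this] show ?thesis by auto
qed

lemma rank_one_psd: "mat m m (\<lambda>(p, q). z p * z q) \<in> psd_mats m"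
proof -
  have "v \<bullet> (mat m m (\<lambda>(p, q). z p * z q) *\<^sub>v v) = (\<Sum>p<m. z p * v $ p)\<^sup>2" if "v \<in> carrier_vec m" for v
    using that by (simp add: scalar_prod_def atLeast0LessThan power2_eq_square sum_product sum_distrib_left mult_ac)
  then show ?thesis by (auto simp: psd_mats_def sym_mats_def intro!: eq_matI)
qed

text \<open>
  The quadratic form of the Choi matrix of \<open>\<beta>\<close>, with rows \<open>(i, r)\<close> and columns \<open>(j, s)\<close>, on \<open>n \<times> n\<close>
  matrices \<open>z\<close> regarded as vectors.
\<close>

definition choi_form :: "nat \<Rightarrow> (nat \<Rightarrow> nat \<Rightarrow> nat \<Rightarrow> nat \<Rightarrow> real) \<Rightarrow> (nat \<Rightarrow> nat \<Rightarrow> real) \<Rightarrow> real" where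
  "choi_form n \<beta> z = (\<Sum>i<n. \<Sum>j<n. \<Sum>r<n. \<Sum>s<n. \<beta> i j r s * z i r * z j s)"

text \<open>
  Take \<open>k = n\<close>, for \<open>U\<close> the rank-one matrix of the maximally entangled vector \<open>\<Sum> e\<^sub>i \<otimes> e\<^sub>i\<close>, whose blocks
  are the matrix units, and for \<open>V\<close> the rank-one matrix of \<open>z\<close>. Then \<open>\<langle>U,V\<rangle>\<close> is the
  square of the trace of \<open>z\<close>.
\<close>

lemma choi_form_nonneg_of_ccp:
  assumes ccp: "completely_cross_positive n B" and z: "(\<Sum>i<n. z i i) = 0"
  shows "choi_form n (\<lambda>i j r s. B (unit_mat n i j) $$ (r, s)) z \<ge> 0"
proof -
  define w \<zeta> :: "nat \<Rightarrow> real" where "w p = delta (p div n) (p mod n)" and "\<zeta> p = z (p div n) (p mod n)" for p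
  define U V where "U = mat (n * n) (n * n) (\<lambda>(p, q). w p * w q)"
    and "V = mat (n * n) (n * n) (\<lambda>(p, q). \<zeta> p * \<zeta> q)"
  have UV: "U \<in> psd_mats (n * n)" "V \<in> psd_mats (n * n)" by (auto simp: U_def V_def rank_one_psd)
  have carr: "U \<in> carrier_mat (n * n) (n * n)" "V \<in> carrier_mat (n * n) (n * n)" by (auto simp: U_def V_def)
  have "(\<Sum>p<n * n. w p * \<zeta> p) = (\<Sum>a<n. \<Sum>i<n. delta a i * z a i)"
    unfolding sum_blocks by (intro sum.cong refl) (simp add: w_def \<zeta>_def)
  also have "\<dots> = 0" using z by (simp add: sum_delta)
  finally have wz: "(\<Sum>p<n * n. w p * \<zeta> p) = 0" .
  have "mat_inner U V = (\<Sum>p<n * n. \<Sum>q<n * n. (w p * \<zeta> p) * (w q * \<zeta> q))"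
    unfolding mat_inner_eq[OF carr] by (intro sum.cong refl) (simp add: U_def V_def mult_ac)
  also have "\<dots> = 0" using wz by (simp add: sum_product[symmetric])
  finally have "0 \<le> mat_inner (ampliation n n B U) V"
    using ccp UV by (auto simp: completely_cross_positive_def)
  also have "\<dots> = (\<Sum>a<n. \<Sum>b<n. \<Sum>r<n. \<Sum>s<n.
      B (mat_block n U a b) $$ (r, s) * V $$ (a * n + r, b * n + s))"
    by (rule mat_inner_ampliation[OF carr(2)])
  also have "\<dots> = choi_form n (\<lambda>i j r s. B (unit_mat n i j) $$ (r, s)) z"
    unfolding choi_form_def
  proof (intro sum.cong refl)
    fix a b r s assume "a \<in> {..<n}" "b \<in> {..<n}" "r \<in> {..<n}" "s \<in> {..<n}"
    moreover from this have "mat_block n U a b = unit_mat n a b"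
      by (intro eq_matI) (auto simp: mat_block_def unit_mat_def U_def block_index_less w_def)
    ultimately show "B (mat_block n U a b) $$ (r, s) * V $$ (a * n + r, b * n + s)
        = B (unit_mat n a b) $$ (r, s) * z a r * z b s"
      by (simp add: V_def block_index_less \<zeta>_def)
  qed
  finally show ?thesis .
qed

text \<open>
  The matrix \<open>z = \<Sum>\<^sub>a u\<^sub>a v\<^sub>a\<^sup>T\<close> of the block vectors \<open>u\<close> and \<open>v\<close> appears when the sums over the two block
  indices are carried out first. The left-hand side is \<open>\<langle>(I\<^sub>k \<otimes> B)(uu\<^sup>T), vv\<^sup>T\<rangle>\<close> for the map \<open>B\<close> with Choi array \<open>\<beta>\<close>.
\<close>

lemma choi_form_ampliation_rank_one:
  "(\<Sum>a<k. \<Sum>b<k. \<Sum>r<n. \<Sum>s<n. (\<Sum>i<n. \<Sum>j<n. (u (a * n + i) * u (b * n + j)) * \<beta> i j r s)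
      * (v (a * n + r) * v (b * n + s)))
    = choi_form n \<beta> (\<lambda>i r. \<Sum>a<k. u (a * n + i) * v (a * n + r))"
proof -
  define T where "T = ({..<n} \<times> {..<n}) \<times> ({..<n} \<times> {..<n})"
  define g where "g a b t = (case t of ((i, j), (r, s)) \<Rightarrow>
    \<beta> i j r s * (u (a * n + i) * v (a * n + r)) * (u (b * n + j) * v (b * n + s)))" for a b t
  have "(\<Sum>r<n. \<Sum>s<n. (\<Sum>i<n. \<Sum>j<n. (u (a * n + i) * u (b * n + j)) * \<beta> i j r s)
      * (v (a * n + r) * v (b * n + s))) = sum (g a b) T" for a b
  proof -
    have "(\<Sum>r<n. \<Sum>s<n. (\<Sum>i<n. \<Sum>j<n. (u (a * n + i) * u (b * n + j)) * \<beta> i j r s)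
        * (v (a * n + r) * v (b * n + s))) = (\<Sum>r<n. \<Sum>s<n. \<Sum>i<n. \<Sum>j<n. g a b ((i, j), (r, s)))"
      by (simp add: g_def sum_distrib_left sum_distrib_right mult_ac)
    also have "\<dots> = (\<Sum>i<n. \<Sum>j<n. \<Sum>r<n. \<Sum>s<n. g a b ((i, j), (r, s)))"
      by (rule sum_swap_pairs)
    finally show ?thesis by (simp add: T_def sum.cartesian_product')
  qed
  then have "(\<Sum>a<k. \<Sum>b<k. \<Sum>r<n. \<Sum>s<n. (\<Sum>i<n. \<Sum>j<n. (u (a * n + i) * u (b * n + j)) * \<beta> i j r s)
      * (v (a * n + r) * v (b * n + s))) = (\<Sum>a<k. \<Sum>b<k. sum (g a b) T)" by simp
  also have "\<dots> = (\<Sum>a<k. \<Sum>t\<in>T. \<Sum>b<k. g a b t)"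
    by (intro sum.cong refl sum.swap)
  also have "\<dots> = (\<Sum>t\<in>T. \<Sum>a<k. \<Sum>b<k. g a b t)"
    by (rule sum.swap)
  also have "\<dots> = choi_form n \<beta> (\<lambda>i r. \<Sum>a<k. u (a * n + i) * v (a * n + r))"
    unfolding choi_form_def T_def sum.cartesian_product'
    by (intro sum.cong refl) (simp add: g_def mult.assoc sum_product, simp add: sum_distrib_left mult_ac)
  finally show ?thesis .
qed

text \<open>
  The Lyapunov part of the Choi form is a multiple of the trace of \<open>z\<close>; the rest is a sum of squares.
\<close>

lemma choi_form_gram_lyap:
  assumes "\<And>i j r s. \<beta> i j r s = (\<Sum>l\<in>L. c l i r * c l j s) + lyap \<kappa> i j r s"
    and z: "(\<Sum>i<n. z i i) = 0"
  shows "choi_form n \<beta> z \<ge> 0"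
proof -
  have swap: "(\<Sum>i<n. \<Sum>j<n. \<Sum>r<n. \<Sum>s<n. f i r * g j s) = (\<Sum>i<n. \<Sum>r<n. f i r) * (\<Sum>j<n. \<Sum>s<n. g j s)"
    for f g :: "nat \<Rightarrow> nat \<Rightarrow> real"
    by (simp add: sum_product)
  have gram: "choi_form n (\<lambda>i j r s. c l i r * c l j s) z = (\<Sum>i<n. \<Sum>r<n. c l i r * z i r)\<^sup>2" for l
    unfolding choi_form_def power2_eq_square swap[symmetric] by (simp add: mult_ac)
  have zero: "choi_form n (\<lambda>i j r s. \<kappa> i r * delta j s) z = 0" "choi_form n (\<lambda>i j r s. delta i r * \<kappa> j s) z = 0"
  proof -
    have "choi_form n (\<lambda>i j r s. \<kappa> i r * delta j s) z
        = (\<Sum>i<n. \<Sum>r<n. \<kappa> i r * z i r) * (\<Sum>j<n. \<Sum>s<n. delta j s * z j s)"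
      unfolding choi_form_def swap[symmetric] by (simp add: mult_ac)
    moreover have "choi_form n (\<lambda>i j r s. delta i r * \<kappa> j s) z
        = (\<Sum>j<n. \<Sum>s<n. delta j s * z j s) * (\<Sum>i<n. \<Sum>r<n. \<kappa> i r * z i r)"
      unfolding choi_form_def swap[symmetric] by (simp add: mult_ac)
    ultimately show "choi_form n (\<lambda>i j r s. \<kappa> i r * delta j s) z = 0"
      "choi_form n (\<lambda>i j r s. delta i r * \<kappa> j s) z = 0"
      using z by (simp_all add: sum_delta)
  qed
  have add: "choi_form n (\<lambda>i j r s. f i j r s + g i j r s) z = choi_form n f z + choi_form n g z" for f g
    by (simp add: choi_form_def distrib_right sum.distrib)
  have sum: "choi_form n (\<lambda>i j r s. \<Sum>l\<in>L. f l i j r s) z = (\<Sum>l\<in>L. choi_form n (f l) z)" for f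
    by (induction L rule: infinite_finite_induct) (simp_all add: add, simp_all add: choi_form_def)
  have "choi_form n \<beta> z = (\<Sum>l\<in>L. (\<Sum>i<n. \<Sum>r<n. c l i r * z i r)\<^sup>2)"
    unfolding assms(1) lyap_def add sum gram zero by simp
  then show ?thesis by (simp add: sum_nonneg)
qed

text \<open>
  Decompose \<open>U\<close> and \<open>V\<close> into rank-one matrices. The number \<open>\<langle>U,V\<rangle>\<close> is the sum of the squared inner
  products of their vectors, so all of these are zero, and the pairing with \<open>(I \<otimes> B)(U)\<close> is a sum of
  values of the Choi form at matrices of trace zero.
\<close>

lemma ccp_choi_map:
  assumes star: "\<And>i j r s. \<beta> j i s r = \<beta> i j r s"
    and nonneg: "\<And>z. (\<Sum>i<n. z i i) = 0 \<Longrightarrow> choi_form n \<beta> z \<ge> 0"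
  shows "completely_cross_positive n (choi_map n \<beta>)"
  unfolding completely_cross_positive_def
proof (intro conjI allI ballI impI)
  show "star_linear n (choi_map n \<beta>)"
    unfolding star_linear_def linear_between_def
  proof (intro conjI ballI allI)
    fix U V :: "real mat" and c assume U: "U \<in> carrier_mat n n" and V: "V \<in> carrier_mat n n"
    show "choi_map n \<beta> U \<in> carrier_mat n n" by (simp add: choi_map_def)
    show "choi_map n \<beta> (U + V) = choi_map n \<beta> U + choi_map n \<beta> V"
      using U V by (intro eq_matI) (auto simp: choi_map_def distrib_right sum.distrib)
    show "choi_map n \<beta> (c \<cdot>\<^sub>m U) = c \<cdot>\<^sub>m choi_map n \<beta> U"
      using U by (intro eq_matI) (auto simp: choi_map_def sum_distrib_left mult.assoc)
    have "(\<Sum>i<n. \<Sum>j<n. transpose_mat U $$ (i, j) * \<beta> i j r s) = (\<Sum>i<n. \<Sum>j<n. U $$ (i, j) * \<beta> i j s r)" for r s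
      by (subst sum.swap, intro sum.cong refl) (use U in \<open>simp add: star\<close>)
    then show "choi_map n \<beta> (transpose_mat U) = transpose_mat (choi_map n \<beta> U)"
      by (intro eq_matI) (auto simp: choi_map_def)
  qed
next
  fix k U V
  assume UV: "U \<in> psd_mats (k * n)" "V \<in> psd_mats (k * n)" and orth: "mat_inner U V = 0"
  obtain M :: nat and u where u: "\<And>p q. p < k * n \<Longrightarrow> q < k * n \<Longrightarrow> U $$ (p, q) = (\<Sum>l<M. u l p * u l q)"
    using psd_mats_gram[OF UV(1)] by blast
  obtain N :: nat and v where v: "\<And>p q. p < k * n \<Longrightarrow> q < k * n \<Longrightarrow> V $$ (p, q) = (\<Sum>l<N. v l p * v l q)"
    using psd_mats_gram[OF UV(2)] by blast
  have carr: "U \<in> carrier_mat (k * n) (k * n)" "V \<in> carrier_mat (k * n) (k * n)"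
    using UV by (auto simp: psd_mats_def sym_mats_def)
  have "0 = (\<Sum>p<k * n. \<Sum>q<k * n. (\<Sum>l<M. u l p * u l q) * (\<Sum>l'<N. v l' p * v l' q))"
    using orth unfolding mat_inner_eq[OF carr] by (simp add: u v)
  also have "\<dots> = (\<Sum>p<k * n. \<Sum>q<k * n. \<Sum>t\<in>{..<M} \<times> {..<N}.
      (u (fst t) p * v (snd t) p) * (u (fst t) q * v (snd t) q))"
    by (simp add: sum_product sum.cartesian_product' mult_ac)
  also have "\<dots> = (\<Sum>t\<in>{..<M} \<times> {..<N}. (\<Sum>p<k * n. u (fst t) p * v (snd t) p)\<^sup>2)"
    unfolding power2_eq_square sum_product
    by (subst sum.swap[of _ "{..<M} \<times> {..<N}"], intro sum.cong refl sum.swap)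
  finally have "\<forall>t\<in>{..<M} \<times> {..<N}. (\<Sum>p<k * n. u (fst t) p * v (snd t) p)\<^sup>2 = 0"
    by (subst sum_nonneg_eq_0_iff[symmetric]) auto
  then have perp: "(\<Sum>p<k * n. u l p * v l' p) = 0" if "l < M" "l' < N" for l l'
    using that by auto
  \<comment> \<open>The pairing \<open>\<langle>(I \<otimes> B)(f), g\<rangle>\<close>, which is bilinear in the entries \<open>f\<close> and \<open>g\<close> of
    the two matrices.\<close>
  define \<Phi> where "\<Phi> f g = (\<Sum>a<k. \<Sum>b<k. \<Sum>r<n. \<Sum>s<n.
    (\<Sum>i<n. \<Sum>j<n. f (a * n + i) (b * n + j) * \<beta> i j r s) * g (a * n + r) (b * n + s))"
    for f g :: "nat \<Rightarrow> nat \<Rightarrow> real"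
  have \<Phi>_left: "\<Phi> (\<lambda>p q. \<Sum>l<m. f l p q) g = (\<Sum>l<m. \<Phi> (f l) g)" for f g and m :: nat
    by (induction m) (simp_all add: \<Phi>_def distrib_right sum.distrib)
  have \<Phi>_right: "\<Phi> f (\<lambda>p q. \<Sum>l<m. g l p q) = (\<Sum>l<m. \<Phi> f (g l))" for f g and m :: nat
    by (induction m) (simp_all add: \<Phi>_def distrib_left sum.distrib)
  have "mat_inner (ampliation k n (choi_map n \<beta>) U) V = (\<Sum>a<k. \<Sum>b<k. \<Sum>r<n. \<Sum>s<n.
      choi_map n \<beta> (mat_block n U a b) $$ (r, s) * V $$ (a * n + r, b * n + s))"
    by (rule mat_inner_ampliation[OF carr(2)])
  also have "\<dots> = \<Phi> (\<lambda>p q. \<Sum>l<M. u l p * u l q) (\<lambda>p q. \<Sum>l<N. v l p * v l q)"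
    unfolding \<Phi>_def by (intro sum.cong refl) (simp add: choi_map_def mat_block_def block_index_less u v)
  also have "\<dots> = (\<Sum>l<M. \<Sum>l'<N. \<Phi> (\<lambda>p q. u l p * u l q) (\<lambda>p q. v l' p * v l' q))"
    by (simp add: \<Phi>_left \<Phi>_right)
  also have "\<dots> \<ge> 0"
  proof (intro sum_nonneg)
    fix l l' assume l: "l \<in> {..<M}" "l' \<in> {..<N}"
    have "(\<Sum>i<n. \<Sum>a<k. u l (a * n + i) * v l' (a * n + i)) = 0"
      using perp[of l l'] l by (subst sum.swap) (simp add: sum_blocks)
    then show "0 \<le> \<Phi> (\<lambda>p q. u l p * u l q) (\<lambda>p q. v l' p * v l' q)"
      unfolding \<Phi>_def choi_form_ampliation_rank_one by (rule nonneg)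
  qed
  finally show "0 \<le> mat_inner (ampliation k n (choi_map n \<beta>) U) V" .
qed

section \<open>The equivalences\<close>

lemma tensor_of_extension:
  assumes B: "linear_between (carrier_mat n n) (carrier_mat n n) B"
    and ext: "\<And>U. U \<in> sym_mats n \<Longrightarrow> B U = A U" and ij: "i < n" "j < n" and rs: "r < n" "s < n"
  shows "tensor n A i j r s = (B (unit_mat n i j) $$ (r, s) + B (unit_mat n j i) $$ (r, s)) / 2"
proof -
  have "sym_unit_mat n i j \<in> sym_mats n"
    by (auto simp: sym_unit_mat_def sym_mats_def intro!: eq_matI)
  then have "tensor n A i j r s = B (sym_unit_mat n i j) $$ (r, s)"
    by (simp add: tensor_def ext)
  also have "\<dots> = (\<Sum>a<n. \<Sum>b<n. sym_unit_mat n i j $$ (a, b) * B (unit_mat n a b) $$ (r, s))"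
    by (rule linear_expansion[OF B _ rs]) (simp add: sym_unit_mat_def)
  also have "\<dots> = (\<Sum>a<n. \<Sum>b<n. B (unit_mat n a b) $$ (r, s) / 2 * (delta a i * delta b j))
      + (\<Sum>a<n. \<Sum>b<n. B (unit_mat n a b) $$ (r, s) / 2 * (delta a j * delta b i))"
    unfolding sum.distrib[symmetric]
    by (intro sum.cong refl) (simp add: sym_unit_mat_def delta_def)
  also have "\<dots> = (B (unit_mat n i j) $$ (r, s) + B (unit_mat n j i) $$ (r, s)) / 2"
    unfolding sum_delta2[OF ij] sum_delta2[OF ij(2) ij(1)] by (simp add: add_divide_distrib)
  finally show ?thesis .
qed

text \<open>
  Decompose the Choi form modulo the trace and replace the coordinate \<open>z\<^sub>i\<^sub>r\<close> by the polynomial \<open>x\<^sub>i y\<^sub>r\<close>.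
\<close>

lemma sos_mod_of_ccp:
  assumes n: "n \<ge> 1" and A: "linear_between (sym_mats n) (sym_mats n) A"
    and ccp: "completely_cross_positive n B" and ext: "\<And>U. U \<in> sym_mats n \<Longrightarrow> B U = A U"
  shows "sos_mod (vars_xy n) (ideal_I n) (p_poly n A)"
proof -
  define \<beta> where "\<beta> i j r s = B (unit_mat n i j) $$ (r, s)" for i j r s
  define S where "S = {..<n} \<times> {..<n}"
  define C where "C I J = \<beta> (fst I) (fst J) (snd I) (snd J)" for I J
  define w where "w I = delta (fst I) (snd I)" for I
  have star: "star_linear n B" using ccp by (simp add: completely_cross_positive_def)
  then have lin: "linear_between (carrier_mat n n) (carrier_mat n n) B" by (simp add: star_linear_def)
  have "\<beta> i j r s = \<beta> j i s r" if "i < n" "j < n" "r < n" "s < n" for i j r s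
  proof -
    have "unit_mat n i j = transpose_mat (unit_mat n j i)"
      by (intro eq_matI) (auto simp: unit_mat_def)
    moreover have "unit_mat n j i \<in> carrier_mat n n" by (simp add: unit_mat_def)
    ultimately have "B (unit_mat n i j) = transpose_mat (B (unit_mat n j i))"
      "B (unit_mat n j i) \<in> carrier_mat n n"
      using star lin by (auto simp: star_linear_def linear_between_def)
    then show ?thesis using that by (simp add: \<beta>_def)
  qed
  then have sym: "C I J = C J I" if "I \<in> S" "J \<in> S" for I J
    using that by (auto simp: C_def S_def)
  have "(\<Sum>I\<in>S. w I * w I) = real n"
    by (simp add: S_def w_def sum.cartesian_product' sum_delta) (simp add: delta_def)
  then have w: "(\<Sum>I\<in>S. w I * w I) \<noteq> 0" using n by simp
  have "0 \<le> (\<Sum>I\<in>S. \<Sum>J\<in>S. C I J * z I * z J)" if "(\<Sum>I\<in>S. w I * z I) = 0" for z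
  proof -
    have "0 \<le> choi_form n \<beta> (\<lambda>i r. z (i, r))"
      unfolding \<beta>_def using that
      by (intro choi_form_nonneg_of_ccp[OF ccp]) (simp add: S_def w_def sum.cartesian_product' sum_delta)
    also have "\<dots> = (\<Sum>I\<in>S. \<Sum>J\<in>S. C I J * z I * z J)"
      unfolding S_def sum.cartesian_product' choi_form_def C_def fst_conv snd_conv
      by (intro sum.cong refl sum.swap)
    finally show ?thesis .
  qed
  from gram_modulo_vector[of S C w, OF _ sym w this] obtain N :: nat and L g
    where gram: "\<And>I J. I \<in> S \<Longrightarrow> J \<in> S \<Longrightarrow> C I J = (\<Sum>l<N. L l I * L l J) + w I * g J + g I * w J"
    by (auto simp: S_def)
  define Z where "Z I = Var (X (fst I + 1)) * Var (Y (snd I + 1))" for I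
  define form where "form c = (\<Sum>I\<in>S. Const (c I) * Z I)" for c
  have form_mult: "form c * form d = (\<Sum>I\<in>S. \<Sum>J\<in>S. Const (c I * d J) * Z I * Z J)" for c d
    by (simp add: form_def sum_product Const_mult mult_ac)
  have "p_poly n A = (\<Sum>i<n. \<Sum>j<n. \<Sum>r<n. \<Sum>s<n. Const (tensor n A i j r s) *
      Var (X (i + 1)) * Var (X (j + 1)) * Var (Y (r + 1)) * Var (Y (s + 1)))"
    by (rule p_poly_eq[OF A])
  also have "\<dots> = (\<Sum>i<n. \<Sum>j<n. \<Sum>r<n. \<Sum>s<n. Const (\<beta> i j r s / 2) * Z (i, r) * Z (j, s))
      + (\<Sum>i<n. \<Sum>j<n. \<Sum>r<n. \<Sum>s<n. Const (\<beta> j i r s / 2) * Z (i, r) * Z (j, s))"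
    unfolding sum.distrib[symmetric]
    by (intro sum.cong refl) (simp add: tensor_of_extension[OF lin ext] \<beta>_def[symmetric] Z_def
        add_divide_distrib Const_add algebra_simps)
  also have "(\<Sum>i<n. \<Sum>j<n. \<Sum>r<n. \<Sum>s<n. Const (\<beta> j i r s / 2) * Z (i, r) * Z (j, s))
      = (\<Sum>i<n. \<Sum>j<n. \<Sum>r<n. \<Sum>s<n. Const (\<beta> i j r s / 2) * Z (i, r) * Z (j, s))"
    by (subst sum.swap) (simp add: Z_def mult_ac)
  also have "\<dots> + \<dots> = (\<Sum>i<n. \<Sum>j<n. \<Sum>r<n. \<Sum>s<n. Const (\<beta> i j r s) * Z (i, r) * Z (j, s))"
  proof -
    have half: "Const (c / 2) * y * z + Const (c / 2) * y * z = Const c * y * z" for c y z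
      unfolding distrib_right[symmetric] Const_add[symmetric] by simp
    show ?thesis unfolding sum.distrib[symmetric] half ..
  qed
  also have "\<dots> = (\<Sum>I\<in>S. \<Sum>J\<in>S. Const (C I J) * Z I * Z J)"
    unfolding S_def sum.cartesian_product' C_def fst_conv snd_conv by (intro sum.cong refl sum.swap)
  also have "\<dots> = (\<Sum>I\<in>S. \<Sum>J\<in>S. (\<Sum>l<N. Const (L l I * L l J) * Z I * Z J)
      + Const (w I * g J) * Z I * Z J + Const (g I * w J) * Z I * Z J)"
    by (intro sum.cong refl) (simp only: gram Const_add Const_sum distrib_right sum_distrib_right)
  also have "\<dots> = (\<Sum>l<N. form (L l) * form (L l)) + form w * form g + form g * form w"
  proof -
    have "(\<Sum>I\<in>S. \<Sum>J\<in>S. \<Sum>l<N. Const (L l I * L l J) * Z I * Z J)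
        = (\<Sum>I\<in>S. \<Sum>l<N. \<Sum>J\<in>S. Const (L l I * L l J) * Z I * Z J)"
      by (intro sum.cong refl sum.swap)
    also have "\<dots> = (\<Sum>l<N. \<Sum>I\<in>S. \<Sum>J\<in>S. Const (L l I * L l J) * Z I * Z J)"
      by (rule sum.swap)
    finally show ?thesis by (simp add: sum.distrib form_mult)
  qed
  finally have p: "p_poly n A - (\<Sum>l = 1..N. (form (L (l - 1)))\<^sup>2) = 2 * form g * form w"
    by (simp add: sum.atLeast1_atMost_eq power2_eq_square)
  have Zpoly: "Z I \<in> polys (vars_xy n)" if "I \<in> S" for I
    using that by (auto simp: Z_def S_def vars_xy_def intro!: polys_closed polys_Var)
  then have form_polys: "form c \<in> polys (vars_xy n)" for c
    by (auto simp: form_def intro!: polys_closed)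
  have "form w = (\<Sum>i<n. \<Sum>j<n. if i = j then Z (i, i) else 0)"
    unfolding form_def S_def sum.cartesian_product'
    by (intro sum.cong refl) (auto simp: w_def delta_def Const_def)
  also have "\<dots> = (\<Sum>i = 1..n. Var (X i) * Var (Y i))"
    by (simp add: Z_def sum.atLeast1_atMost_eq)
  finally have w: "form w = (\<Sum>i = 1..n. Var (X i) * Var (Y i))" .
  have "2 * form g \<in> polys (vars_xy n)"
    using polys_add[OF form_polys form_polys, of g g] by simp
  then have "2 * form g * form w \<in> ideal_I n"
    unfolding w by (rule multiple_in_ideal_I)
  then have "p_poly n A - (\<Sum>l = 1..N. (form (L (l - 1)))\<^sup>2) \<in> ideal_I n"
    by (simp only: p)
  then show ?thesis
    unfolding sos_mod_def
    by (intro exI[of _ N] exI[of _ "\<lambda>l. form (L (l - 1))"] conjI ballI form_polys)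
qed

lemma mem_vars_xa [simp]: "X i \<in> vars_xa n \<longleftrightarrow> 1 \<le> i \<and> i \<le> n" "Alpha k \<in> vars_xa n \<longleftrightarrow> 1 \<le> k \<and> k \<le> n - 1"
  by (auto simp: vars_xa_def)

lemma sos_of_sos_mod:
  assumes n: "n \<ge> 2" and sos: "sos_mod (vars_xy n) (ideal_I n) (p_poly n A)"
  shows "sos (vars_xa n) (q_poly n A)"
proof -
  obtain k :: nat and f where f: "\<And>i. i \<in> {1..k} \<Longrightarrow> f i \<in> polys (vars_xy n)"
    and I: "p_poly n A - (\<Sum>i = 1..k. (f i)\<^sup>2) \<in> ideal_I n"
    using sos unfolding sos_mod_def by blast
  have "q_poly n A = (\<Sum>i = 1..k. (subst (Psi n) (f i))\<^sup>2)"
    using subst_vanishes_on_ideal_I[OF subst_Psi_generator[OF n] I]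
    by (simp add: q_poly_def subst_hom.ev_simps)
  moreover have "Psi n v \<in> polys (vars_xa n)" if "v \<in> vars_xy n" for v
    using that n by (auto simp: vars_xy_def psi_y_def intro!: polys_closed polys_Var; arith)
  then have "subst (Psi n) (f i) \<in> polys (vars_xa n)" if "i \<in> {1..k}" for i
    using subst_in_polys[OF f[OF that]] by blast
  ultimately show ?thesis unfolding sos_def by (intro exI[of _ k] exI[of _ "\<lambda>i. subst (Psi n) (f i)"]) auto
qed

text \<open>
  The extension is the map whose Choi array is the sum of the Gram part \<open>\<gamma>\<close>, read off from the
  squares, and a Lyapunov part that accounts for the difference to \<open>A\<close>.
\<close>

lemma ccp_of_sos:
  assumes n: "n \<ge> 2" and A: "linear_between (sym_mats n) (sym_mats n) A"
    and sos: "sos (vars_xa n) (q_poly n A)"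
  shows "\<exists>B. completely_cross_positive n B \<and> (\<forall>U\<in>sym_mats n. B U = A U)"
proof -
  define d where "d = tensor n A"
  obtain k :: nat and f where f: "\<And>l. l \<in> {1..k} \<Longrightarrow> f l \<in> polys (vars_xa n)"
    and q: "q_poly n A = (\<Sum>l = 1..k. (f l)\<^sup>2)"
    using sos unfolding sos_def by blast
  define \<phi> where "\<phi> l x \<alpha> = real_ev.ev (point x \<alpha>) (f l)" for l x \<alpha>
  have biq_d: "biq n d x (perp_vec n x \<alpha>) = (\<Sum>l = 1..k. (\<phi> l x \<alpha>)\<^sup>2)" for x \<alpha>
    using eval_q_poly[OF n A, of x \<alpha>] by (simp add: q real_ev.ev_simps d_def \<phi>_def)
  have bound: "(\<phi> l x \<alpha>)\<^sup>2 \<le> biq n d x (perp_vec n x \<alpha>)" if "l \<in> {1..k}" for l x \<alpha>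
    unfolding biq_d using that by (intro member_le_sum) auto
  have "\<exists>c. \<forall>x \<alpha>. \<phi> l x \<alpha> = (\<Sum>i<n. \<Sum>r<n. c i r * x i * perp_vec n x \<alpha> r)" if l: "l \<in> {1..k}" for l
  proof -
    obtain F where F: "\<And>x \<alpha>. \<phi> l x \<alpha> = (\<Sum>k<n-1. \<alpha> k * quad n (F k) x)"
      using bihomogeneous_of_square_bound[OF f[OF l], of d] bound[OF l] by (auto simp: \<phi>_def)
    have "(\<Sum>k<n-1. \<alpha> k * quad n (F k) x) = 0" if "\<And>r. r < n \<Longrightarrow> perp_vec n x \<alpha> r = 0" for x \<alpha>
    proof -
      have "biq n d x (perp_vec n x \<alpha>) = 0" using that by (simp add: biq_def)
      then show ?thesis using bound[OF l, of x \<alpha>] by (simp add: F)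
    qed
    from bilinear_of_vanishing[of n F, OF this] show ?thesis by (simp add: F)
  qed
  then have "\<forall>l\<in>{1..k}. \<exists>c. \<forall>x \<alpha>. \<phi> l x \<alpha> = (\<Sum>i<n. \<Sum>r<n. c i r * x i * perp_vec n x \<alpha> r)"
    by blast
  from bchoice[OF this] obtain c
    where c: "\<And>l x \<alpha>. l \<in> {1..k} \<Longrightarrow> \<phi> l x \<alpha> = (\<Sum>i<n. \<Sum>r<n. c l i r * x i * perp_vec n x \<alpha> r)"
    by blast
  define \<gamma> where "\<gamma> i j r s = (\<Sum>l = 1..k. c l i r * c l j s)" for i j r s
  \<comment> \<open>The array \<open>d\<close> is symmetric in \<open>i, j\<close> and in \<open>r, s\<close>, while \<open>\<gamma>\<close> is so only after
    symmetrization; the factor 2 avoids fractions.\<close>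
  define e where "e i j r s = 2 * d i j r s - (\<gamma> i j r s + \<gamma> j i r s)" for i j r s
  have biq_\<gamma>: "biq n \<gamma> x y = (\<Sum>l = 1..k. (\<Sum>i<n. \<Sum>r<n. c l i r * x i * y r)\<^sup>2)" for x y
  proof -
    have "biq n (\<lambda>i j r s. \<Sum>l = 1..m. c l i r * c l j s) x y
        = (\<Sum>l = 1..m. biq n (\<lambda>i j r s. c l i r * c l j s) x y)" for m
      by (induction m) (simp_all add: biq_add, simp add: biq_def)
    moreover have "biq n (\<lambda>i j r s. c l i r * c l j s) x y = (\<Sum>i<n. \<Sum>r<n. c l i r * x i * y r)\<^sup>2" for l
      unfolding biq_def power2_eq_square sum_product by (simp only: mult_ac)
    ultimately show ?thesis unfolding \<gamma>_def by simp
  qed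
  have biq_e: "biq n e x y = 2 * (biq n d x y - biq n \<gamma> x y)" for x y
    unfolding e_def biq_diff biq_add biq_cmult biq_swap[of n \<gamma>] by simp
  have "biq n e x y = 0" if nz: "\<And>i. i < n \<Longrightarrow> x i \<noteq> 0" and perp: "(\<Sum>i<n. x i * y i) = 0" for x y
  proof -
    obtain \<alpha> where \<alpha>: "\<And>r. r < n \<Longrightarrow> perp_vec n x \<alpha> r = y r"
      using perp_vec_surj[OF n nz perp] by blast
    have "biq n e x y = biq n e x (perp_vec n x \<alpha>)" by (simp add: biq_def \<alpha>)
    also have "\<dots> = 0" by (simp add: biq_e biq_d biq_\<gamma> c)
    finally show ?thesis .
  qed
  then have "biq n e x y = 0" if "(\<Sum>i<n. x i * y i) = 0" for x y
    using biq_vanishes_by_density[of n e x y] that by blast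
  moreover have "d i j r s = d j i r s" for i j r s
    by (simp add: d_def tensor_def sym_unit_mat_def add.commute)
  moreover have "d i j r s = d i j s r" if "r < n" "s < n" for i j r s
  proof -
    have "sym_unit_mat n i j \<in> sym_mats n"
      by (auto simp: sym_unit_mat_def sym_mats_def intro!: eq_matI)
    then have M: "A (sym_unit_mat n i j) \<in> carrier_mat n n"
      "transpose_mat (A (sym_unit_mat n i j)) = A (sym_unit_mat n i j)"
      using A by (auto simp: linear_between_def sym_mats_def)
    show ?thesis
      using arg_cong[OF M(2), of "\<lambda>M. M $$ (s, r)"] M(1) that by (simp add: d_def tensor_def)
  qed
  ultimately obtain \<kappa> where \<kappa>: "\<And>i j r s. i < n \<Longrightarrow> j < n \<Longrightarrow> r < n \<Longrightarrow> s < n \<Longrightarrow>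
      2 * e i j r s = lyap \<kappa> i j r s + lyap \<kappa> j i r s"
    using biq_vanishing_on_perp[of n e] by (auto simp: e_def \<gamma>_def mult.commute add.commute)
  define \<kappa>2 where "\<kappa>2 i r = \<kappa> i r / 2" for i r
  have lyap: "lyap \<kappa> i j r s = 2 * lyap \<kappa>2 i j r s" for i j r s
    by (simp add: lyap_def \<kappa>2_def)
  define \<beta> where "\<beta> i j r s = \<gamma> i j r s + lyap \<kappa>2 i j r s" for i j r s
  have d: "d i j r s = (\<beta> i j r s + \<beta> j i r s) / 2" if "i < n" "j < n" "r < n" "s < n" for i j r s
    using \<kappa>[OF that] by (simp add: e_def \<beta>_def lyap)
  have "completely_cross_positive n (choi_map n \<beta>)"
  proof (rule ccp_choi_map)
    show "\<beta> j i s r = \<beta> i j r s" for i j r s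
      by (simp add: \<beta>_def \<gamma>_def lyap_def mult.commute add.commute)
    show "0 \<le> choi_form n \<beta> z" if "(\<Sum>i<n. z i i) = 0" for z
      by (rule choi_form_gram_lyap[where n = n and z = z and c = c and L = "{1..k}" and \<kappa> = \<kappa>2])
        (simp_all add: \<beta>_def \<gamma>_def that)
  qed
  moreover have "choi_map n \<beta> U = A U" if U: "U \<in> sym_mats n" for U
  proof (rule eq_matI)
    have carr: "U \<in> carrier_mat n n" "A U \<in> carrier_mat n n" and tr: "transpose_mat U = U"
      using U A by (auto simp: linear_between_def sym_mats_def)
    have sym: "U $$ (j, i) = U $$ (i, j)" if "i < n" "j < n" for i j
      using arg_cong[OF tr, of "\<lambda>M. M $$ (i, j)"] that carr by simp
    show "dim_row (choi_map n \<beta> U) = dim_row (A U)" "dim_col (choi_map n \<beta> U) = dim_col (A U)"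
      using carr by (simp_all add: choi_map_def)
    fix r s assume "r < dim_row (A U)" "s < dim_col (A U)"
    then have rs: "r < n" "s < n" using carr by auto
    have "A U $$ (r, s) = (\<Sum>i<n. \<Sum>j<n. U $$ (i, j) * d i j r s)"
      unfolding d_def tensor_def by (rule sym_linear_expansion[OF A U rs])
    also have "\<dots> = (\<Sum>i<n. \<Sum>j<n. U $$ (i, j) * \<beta> i j r s / 2) + (\<Sum>i<n. \<Sum>j<n. U $$ (i, j) * \<beta> j i r s / 2)"
      unfolding sum.distrib[symmetric] by (intro sum.cong refl) (use rs in \<open>simp add: d field_simps\<close>)
    also have "(\<Sum>i<n. \<Sum>j<n. U $$ (i, j) * \<beta> j i r s / 2) = (\<Sum>i<n. \<Sum>j<n. U $$ (i, j) * \<beta> i j r s / 2)"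
      by (subst sum.swap, intro sum.cong refl) (simp add: sym)
    finally show "choi_map n \<beta> U $$ (r, s) = A U $$ (r, s)"
      using rs by (simp add: choi_map_def sum_divide_distrib[symmetric])
  qed
  ultimately show ?thesis by blast
qed

theorem proposition2p6:
  fixes n :: nat and A :: "real mat \<Rightarrow> real mat"
  assumes "n \<ge> 2"
    and "linear_between (sym_mats n) (sym_mats n) A"
  shows "((\<exists>B. completely_cross_positive n B \<and> (\<forall>U\<in>sym_mats n. B U = A U))
            \<longleftrightarrow> sos_mod (vars_xy n) (ideal_I n) (p_poly n A))
       \<and> (sos_mod (vars_xy n) (ideal_I n) (p_poly n A)
            \<longleftrightarrow> sos (vars_xa n) (q_poly n A))"
  using sos_mod_of_ccp[of n A] sos_of_sos_mod[of n A] ccp_of_sos[of n A] assms by auto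

end
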